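(* In each of the types $E_6^{(1)}$, $E_7^{(1)}$ and $E_8^{(1)}$, a Young wall $Y=(z^{n_r}y_r)_{r\ge0}$ lies in $\mathcal Z(\Lambda_0)$ if and only if $$|z^{n_r}y_r|_0>|z^{n_{r+1}}y_{r+1}|_0-H(y_{r+1}\otimes y_r)+m_r-m_{r+1}$$ for all $r\ge0$, where $|z^{n_r}y_r|_0$ is the (signed) difference in the number of $0$-blocks between $z^{n_r}y_r$ and column $r$ of the ground state wall.
   Context: **Notation.** $\hat{\mathfrak g}$ is the untwisted affine Kac–Moody algebra of type $E_6^{(1)},E_7^{(1)}$ or $E_8^{(1)}$, with index set $I=\{0,\dots,n\}$ ($n=6,7,8$) and fundamental weights $\Lambda_i$. Dynkin diagrams (Bourbaki): $E_6^{(1)}$: chain $1-3-4-5-6$ together with $4-2-0$; $E_7^{(1)}$: chain $0-1-3-4-5-6-7$ together with $4-2$; $E_8^{(1)}$: chain $0-8-7-6-5-4-3-1$ together with $4-2$. **Crystals.** On a tensor product of crystals: $\tilde f_i(b\otimes b')=\tilde f_ib\otimes b'$ if $\varphi_i(b)>\varepsilon_i(b')$ and $b\otimes\tilde f_ib'$ otherwise; $\tilde e_i(b\otimes b')=\tilde e_ib\otimes b'$ if $\varphi_i(b)\ge\varepsilon_i(b')$ and $b\otimes\tilde e_ib'$ otherwise. The affinization of a classical crystal $C$ is $C_{\mathrm{aff}}=\{z^mc:m\in\mathbb Z,c\in C\}$ with $\tilde e_i(z^mc)=z^{m+\delta_{i0}}\tilde e_ic$, $\tilde f_i(z^mc)=z^{m-\delta_{i0}}\tilde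 f_ic$, and $\varepsilon_i,\varphi_i$ as for $c$. **Young column patterns.** A Young column pattern is an infinite vertical strip of unit cubes indexed by $k\in\mathbb Z$ (height increasing with $k$), each cut by vertical cuts into blocks coloured by $I$. The horizontal cross-section of every cube is a grid with $w$ columns of cells (numbered $1,\dots,w$ from left to right) and two rows (upper, lower), $w=2,3,6$ in types $E_6^{(1)},E_7^{(1)},E_8^{(1)}$. A block is the full-height prism over a union of cells. Write $u/l$ for a cross-section whose upper row has colours $u$ and lower row has colours $l$ (just $u$ if both rows agree); equally coloured cells of one cube form a single block, except that in type $E_8^{(1)}$ a cube $444444$ consists of two $4$-blocks, one over cell columns $1$–$3$ and one over cell columns $4$–$6$. Rotation by $180^\circ$ sends $u/l$ to $\mathrm{rev}(l)/\mathrm{rev}(u)$, where rev reverses a word. - $E_6^{(1)}$ (period 12): cubes $1,\dots,6$ are $44/04$; $25$; $46/44$; $35$; $44/14$; $32$; cube $k+6$ is the rotation of cube $k$ for all $k$. - $E_7^{(1)}$ (period 8): cubes $1,\dots,8$ are $332/032$; $144$; $355/335$; $446$; $257/255$; $446$; $355/335$; $144$. - $E_8^{(1)}$ (period 20): cubes $1,\dots,10$ are $775522/075552$; $866444$; $755533/775533$; $664441$; $552233/555233$; $444444$; $332555/332255$; $144466$; $335577/335557$; $444668$; cube $k+10$ is the rotation of cube $k$ for all $k$. **Young columns.** A Young column is a nonempty collection of blocks of the pattern of bounded height with no empty space below any block: if a block of cube $k$ belongs to it, so does every block of cube $k-1$ lying below at least one of its cells. Young columns are equivalent if obtained from one another by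 vertical translation and/or rotation by $180^\circ$ about the vertical axis. In type $E_8^{(1)}$ two further equivalence classes of collections also count as Young columns, those of: (S1) all blocks of cubes $k\le4$, the $5$- and $3$-blocks of cube 5, and the $4$-block over cell columns 4–6 of cube 6; (S2) all blocks of cubes $k\le5$, the $4$-block over cell columns 4–6 of cube 6, and the $2$-block of cube 7. An $i$-block of a Young column is removable if removing it leaves a Young column; an $i$-block not in it is addable if adding it gives a Young column. $\tilde f_i$ adds an addable $i$-block if one exists and gives $0$ otherwise; $\tilde e_i$ removes a removable $i$-block if one exists and gives $0$ otherwise; in type $E_8^{(1)}$ with these rules: (a) if there are two addable $i$-blocks, $\tilde f_i$ adds the higher one if $i\ne4$ and the one lying on top of a $5$-block if $i=4$; if there are two removable $i$-blocks, $\tilde e_i$ removes the lower one if $i\neq4$ and the one lying on top of a $3$-block if $i=4$; (b) if a Young column $y$ is obtained by adding (resp. removing) an $i$-block to (from) another Young column by these rules and $y$ itself has an addable (resp. removable) $i$-block, then $\tilde f_j(y)=\tilde e_j(y)=0$ for all $j\neq i$. Put $\varphi_i(y)=\max\{m:\tilde f_i^my\ne0\}$, $\varepsilon_i(y)=\max\{m:\tilde e_i^my\neq0\}$. The set $C$ of equivalence classes becomes a classical crystal with $\mathrm{wt}(y)=\sum_i(\varphi_i(y)-\varepsilon_i(y))\Lambda_i$. **Energy functions.** $H:C\otimes C\to\mathbb Z$ is the function with $H(\tilde f_i(b\otimes b'))=H(b\otimes b')$ for $i\ne0$, and, when $\tilde f_0(b\otimes b')\neq0$, $H(\tilde f_0(b\otimes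 b'))=H(b\otimes b')+1$ if $\tilde f_0(b\otimes b')=\tilde f_0b\otimes b'$ and $H(b\otimes b')-1$ if $\tilde f_0(b\otimes b')=b\otimes\tilde f_0b'$; normalised by $H(c\otimes c)=0$ for extremal $c$ (all $c$ in types $E_6^{(1)},E_7^{(1)}$; all $c$ of nonzero weight in type $E_8^{(1)}$). $H_{\mathrm{aff}}(z^ma\otimes z^nb)=H(a\otimes b)+m-n$. **Young walls.** The Young wall pattern has columns indexed $r=0,1,2,\dots$ from right to left. In type $E_6^{(1)}$, cube $k$ of column $r$ is cube $k+8r$ of the Young column pattern; in type $E_7^{(1)}$, column $r$ is the Young column pattern for $r$ even, and for $r$ odd its cube $k$ is the rotation of cube $k+4$ of the Young column pattern; in type $E_8^{(1)}$ every column is the Young column pattern. Each column pattern is thus a translated/rotated copy of the Young column pattern, so Young columns in column $r$, their classes in $C$ and the operators $\tilde e_i,\tilde f_i$ make sense. The ground state wall consists in every column $r$ of all blocks of cubes $k\le0$ together with: ($E_6^{(1)}$) the three-cell block of cube 1, the block over cell column 2 of cube 2, the one-cell block of cube 3; ($E_7^{(1)}$) all blocks of cube 1 except the one-cell block, the block over cell columns 2–3 of cube 2, the block of cube 3 containing cell column 3, the block over cell column 3 of cube 4, the one-cell block of cube 5; ($E_8^{(1)}$) the blocks of colours $7,5,2$ in cube 1; $6,4$ in cube 2; $5,3$ in cube 3; $4,1$ in cube 4; $2,3$ in cube 5; the $4$-block over cell columns 4–6 in cube 6; and the blocks of colours $5,6,7,8,0$ in cubes $7,8,9,10,11$ respectively.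 Let $b_r\in C$ be the class of column $r$ of the ground state wall, and let $m_r\in\mathbb Z$ be given by $m_0=0$ and $H_{\mathrm{aff}}(z^{m_{r+1}}b_{r+1}\otimes z^{m_r}b_r)=1$ for all $r\ge0$. A Young wall is a collection of blocks of the Young wall pattern which differs from the ground state wall in finitely many blocks and each of whose columns is a Young column. The Young columns in column $r$ are identified with the elements $z^my$ of $C_{\mathrm{aff}}$ by the bijection commuting with all $\tilde e_i,\tilde f_i$ which sends column $r$ of the ground state wall to $z^{m_r}b_r$; so a Young wall is written $(z^{n_r}y_r)_{r\ge0}$. $\mathcal Z(\Lambda_0)$ is the set of Young walls $(z^{n_r}y_r)_{r\ge0}$ with $H_{\mathrm{aff}}(z^{n_{r+1}}y_{r+1}\otimes z^{n_r}y_r)>0$ for all $r\ge0$. *)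

theory Defs
  imports Main
begin

section \<open>Young column patterns\<close>

datatype affine_type = E6 | E7 | E8

text \<open>The affine types \<open>E\<^sub>6\<^sup>(\<^sup>1\<^sup>)\<close>, \<open>E\<^sub>7\<^sup>(\<^sup>1\<^sup>)\<close>, \<open>E\<^sub>8\<^sup>(\<^sup>1\<^sup>)\<close>.
  The index set of type \<open>T\<close> is \<open>{0..rank T}\<close>; colours are elements of it.\<close>

fun rank :: "affine_type \<Rightarrow> nat" where
  "rank E6 = 6" | "rank E7 = 7" | "rank E8 = 8"

fun width :: "affine_type \<Rightarrow> nat" where
  "width E6 = 2" | "width E7 = 3" | "width E8 = 6"

text \<open>A cross-section \<open>u/l\<close> is the pair of the colour words of its upper and lower row.\<close>

type_synonym cross_section = "nat list \<times> nat list"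

fun rot_section :: "cross_section \<Rightarrow> cross_section" where
  "rot_section (u, l) = (rev l, rev u)"

fun base_cubes :: "affine_type \<Rightarrow> cross_section list" where
  "base_cubes E6 =
    [([4,4], [0,4]),
     ([2,5], [2,5]),
     ([4,6], [4,4]),
     ([3,5], [3,5]),
     ([4,4], [1,4]),
     ([3,2], [3,2])]"
| "base_cubes E7 =
    [([3,3,2], [0,3,2]),
     ([1,4,4], [1,4,4]),
     ([3,5,5], [3,3,5]),
     ([4,4,6], [4,4,6]),
     ([2,5,7], [2,5,5]),
     ([4,4,6], [4,4,6]),
     ([3,5,5], [3,3,5]),
     ([1,4,4], [1,4,4])]"
| "base_cubes E8 =
    [([7,7,5,5,2,2], [0,7,5,5,5,2]),
     ([8,6,6,4,4,4], [8,6,6,4,4,4]),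
     ([7,5,5,5,3,3], [7,7,5,5,3,3]),
     ([6,6,4,4,4,1], [6,6,4,4,4,1]),
     ([5,5,2,2,3,3], [5,5,5,2,3,3]),
     ([4,4,4,4,4,4], [4,4,4,4,4,4]),
     ([3,3,2,5,5,5], [3,3,2,2,5,5]),
     ([1,4,4,4,6,6], [1,4,4,4,6,6]),
     ([3,3,5,5,7,7], [3,3,5,5,5,7]),
     ([4,4,4,6,6,8], [4,4,4,6,6,8])]"

text \<open>\<open>base_cubes T ! 0\<close> is cube \<open>1\<close>.  The list is continued periodically in type \<open>E7\<close>,
  and with a rotation after each run through the list in types \<open>E6\<close> and \<open>E8\<close>.\<close>

definition cube :: "affine_type \<Rightarrow> int \<Rightarrow> cross_section" where
  "cube T k =
    (let p = int (length (base_cubes T));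
         x = base_cubes T ! nat ((k - 1) mod p)
     in if T \<noteq> E7 \<and> odd ((k - 1) div p) then rot_section x else x)"

datatype row = Upper | Lower

text \<open>A cell is given by its row and its cell column \<open>1, \<dots>, width T\<close>; a block by the
  index of its cube, the cells of the cross-section over which it is the prism, and its colour.\<close>

type_synonym cell = "row \<times> nat"

datatype block = Block (height: int) (cells: "cell set") (colour: nat)

fun region :: "cross_section \<Rightarrow> nat \<Rightarrow> cell set" where
  "region (u, l) i =
     {(Upper, j) | j. 1 \<le> j \<and> j \<le> length u \<and> u ! (j - 1) = i} \<union>
     {(Lower, j) | j. 1 \<le> j \<and> j \<le> length l \<and> l ! (j - 1) = i}"

definition cube_blocks :: "int \<Rightarrow> cross_section \<Rightarrow> block set" where
  "cube_blocks k x =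
    (if x = (replicate 6 4, replicate 6 4)
     then {Block k (UNIV \<times> {1..3}) 4, Block k (UNIV \<times> {4..6}) 4}
     else {Block k (region x i) i | i. region x i \<noteq> {}})"

definition column_pattern :: "affine_type \<Rightarrow> block set" where
  "column_pattern T = (\<Union>k. cube_blocks k (cube T k))"


section \<open>Young columns\<close>

text \<open>Vertical translation by \<open>t\<close>, followed by the rotation by 180 degrees if \<open>\<rho>\<close> holds.
  Blocks carry their colours, so equivalence of collections of blocks respects colours.\<close>

fun rot_cell :: "affine_type \<Rightarrow> cell \<Rightarrow> cell" where
  "rot_cell T (a, j) = ((if a = Upper then Lower else Upper), width T + 1 - j)"

fun move :: "affine_type \<Rightarrow> int \<Rightarrow> bool \<Rightarrow> block \<Rightarrow> block" where
  "move T t \<rho> (Block k S i) = Block (k + t) (if \<rho> then rot_cell T ` S else S) i"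

definition equivalent :: "affine_type \<Rightarrow> block set \<Rightarrow> block set \<Rightarrow> bool" where
  "equivalent T A B \<longleftrightarrow> (\<exists>t \<rho>. B = move T t \<rho> ` A)"

text \<open>In type \<open>E8\<close> the collections equivalent to one of the following two also count as
  Young columns, although in each of them some block has empty space below it.\<close>

definition special1 :: "block set" where
  "special1 =
     {b \<in> column_pattern E8. height b \<le> 4} \<union>
     {b \<in> column_pattern E8. height b = 5 \<and> colour b \<in> {5, 3}} \<union>
     {Block 6 (UNIV \<times> {4..6}) 4}"

definition special2 :: "block set" where
  "special2 =
     {b \<in> column_pattern E8. height b \<le> 5} \<union>
     {Block 6 (UNIV \<times> {4..6}) 4} \<union>
     {b \<in> column_pattern E8. height b = 7 \<and> colour b = 2}"

text \<open>In what follows, \<open>P\<close> is a translated and/or rotated copy of \<open>column_pattern T\<close>.\<close>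

definition no_empty_space_below :: "block set \<Rightarrow> block set \<Rightarrow> bool" where
  "no_empty_space_below P Y \<longleftrightarrow>
     (\<forall>b\<in>Y. \<forall>b'\<in>P. height b' = height b - 1 \<and> cells b' \<inter> cells b \<noteq> {} \<longrightarrow> b' \<in> Y)"

definition young_columns :: "affine_type \<Rightarrow> block set \<Rightarrow> block set set" where
  "young_columns T P =
     {Y. Y \<subseteq> P \<and> Y \<noteq> {} \<and> (\<exists>K. \<forall>b\<in>Y. height b \<le> K) \<and> no_empty_space_below P Y} \<union>
     {Y. T = E8 \<and> Y \<subseteq> P \<and> (equivalent T special1 Y \<or> equivalent T special2 Y)}"

definition addable :: "affine_type \<Rightarrow> block set \<Rightarrow> nat \<Rightarrow> block set \<Rightarrow> block set" where
  "addable T P i Y = {b \<in> P. colour b = i \<and> b \<notin> Y \<and> insert b Y \<in> young_columns T P}"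

definition removable :: "affine_type \<Rightarrow> block set \<Rightarrow> nat \<Rightarrow> block set \<Rightarrow> block set" where
  "removable T P i Y = {b \<in> Y. colour b = i \<and> Y - {b} \<in> young_columns T P}"

definition on_top_of :: "block set \<Rightarrow> nat \<Rightarrow> block \<Rightarrow> bool" where
  "on_top_of P i b \<longleftrightarrow>
     (\<exists>b'\<in>P. colour b' = i \<and> height b' = height b - 1 \<and> cells b' \<inter> cells b \<noteq> {})"

text \<open>\<open>None\<close> plays the role of \<open>0\<close>.  The choice of the block is forced: there is at most one
  addable (removable) \<open>i\<close>-block, except that in type \<open>E8\<close> there can be two, and then the
  displayed condition singles out one of them.\<close>

definition add_block ::
    "affine_type \<Rightarrow> block set \<Rightarrow> nat \<Rightarrow> block set \<Rightarrow> block set option" where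
  "add_block T P i Y =
    (let A = addable T P i Y
     in if A = {} then None
        else Some (insert (SOME b. b \<in> A \<and>
               (T = E8 \<and> card A = 2 \<longrightarrow>
                 (if i = 4 then on_top_of P 5 b else (\<forall>b'\<in>A. height b' \<le> height b)))) Y))"

definition remove_block ::
    "affine_type \<Rightarrow> block set \<Rightarrow> nat \<Rightarrow> block set \<Rightarrow> block set option" where
  "remove_block T P i Y =
    (let A = removable T P i Y
     in if A = {} then None
        else Some (Y - {SOME b. b \<in> A \<and>
               (T = E8 \<and> card A = 2 \<longrightarrow>
                 (if i = 4 then on_top_of P 3 b else (\<forall>b'\<in>A. height b \<le> height b')))}))"

text \<open>\<open>Y\<close> is the middle element of an \<open>i\<close>-string of length two; in type \<open>E8\<close> such a \<open>Y\<close>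
  is annihilated by all the operators with index different from \<open>i\<close>.\<close>

definition middle :: "affine_type \<Rightarrow> block set \<Rightarrow> nat \<Rightarrow> block set \<Rightarrow> bool" where
  "middle T P i Y \<longleftrightarrow>
     (\<exists>X \<in> young_columns T P. add_block T P i X = Some Y) \<and> addable T P i Y \<noteq> {} \<or>
     (\<exists>X \<in> young_columns T P. remove_block T P i X = Some Y) \<and> removable T P i Y \<noteq> {}"

definition col_f :: "affine_type \<Rightarrow> block set \<Rightarrow> nat \<Rightarrow> block set \<Rightarrow> block set option" where
  "col_f T P i Y =
    (if T = E8 \<and> (\<exists>j. j \<noteq> i \<and> middle T P j Y) then None else add_block T P i Y)"

definition col_e :: "affine_type \<Rightarrow> block set \<Rightarrow> nat \<Rightarrow> block set \<Rightarrow> block set option" where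
  "col_e T P i Y =
    (if T = E8 \<and> (\<exists>j. j \<noteq> i \<and> middle T P j Y) then None else remove_block T P i Y)"


section \<open>The classical crystal of equivalence classes and its affinization\<close>

type_synonym young_class = "block set set"

text \<open>The argument of \<open>class_of\<close> need not be a collection of blocks of \<open>column_pattern T\<close>
  itself: it may be a Young column in a translated and/or rotated copy of that pattern.\<close>

definition class_of :: "affine_type \<Rightarrow> block set \<Rightarrow> young_class" where
  "class_of T Y = {Z \<in> young_columns T (column_pattern T). equivalent T Y Z}"

definition crystal :: "affine_type \<Rightarrow> young_class set" where
  "crystal T = class_of T ` young_columns T (column_pattern T)"

definition cl_f :: "affine_type \<Rightarrow> nat \<Rightarrow> young_class \<Rightarrow> young_class option" where
  "cl_f T i c = map_option (class_of T) (col_f T (column_pattern T) i (SOME Y. Y \<in> c))"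

definition cl_e :: "affine_type \<Rightarrow> nat \<Rightarrow> young_class \<Rightarrow> young_class option" where
  "cl_e T i c = map_option (class_of T) (col_e T (column_pattern T) i (SOME Y. Y \<in> c))"

definition max_steps :: "('a \<Rightarrow> 'a option) \<Rightarrow> 'a \<Rightarrow> nat" where
  "max_steps g x = Max {m. ((\<lambda>y. Option.bind y g) ^^ m) (Some x) \<noteq> None}"

definition \<phi> :: "affine_type \<Rightarrow> nat \<Rightarrow> young_class \<Rightarrow> nat" where
  "\<phi> T i = max_steps (cl_f T i)"

definition \<epsilon> :: "affine_type \<Rightarrow> nat \<Rightarrow> young_class \<Rightarrow> nat" where
  "\<epsilon> T i = max_steps (cl_e T i)"

text \<open>The weight as the family of its coefficients with respect to the fundamental weights.\<close>

definition wt :: "affine_type \<Rightarrow> young_class \<Rightarrow> nat \<Rightarrow> int" where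
  "wt T c = (\<lambda>i. if i \<le> rank T then int (\<phi> T i c) - int (\<epsilon> T i c) else 0)"

fun tensor_f ::
    "affine_type \<Rightarrow> nat \<Rightarrow> young_class \<times> young_class \<Rightarrow> (young_class \<times> young_class) option" where
  "tensor_f T i (b, b') =
     (if \<phi> T i b > \<epsilon> T i b' then map_option (\<lambda>a. (a, b')) (cl_f T i b)
      else map_option (\<lambda>a'. (b, a')) (cl_f T i b'))"

text \<open>The pair \<open>(m, c)\<close> stands for \<open>z\<^sup>m c\<close>.\<close>

definition affinization :: "affine_type \<Rightarrow> (int \<times> young_class) set" where
  "affinization T = UNIV \<times> crystal T"

fun aff_f :: "affine_type \<Rightarrow> nat \<Rightarrow> int \<times> young_class \<Rightarrow> (int \<times> young_class) option" where
  "aff_f T i (m, c) = map_option (\<lambda>c'. (m - (if i = 0 then 1 else 0), c')) (cl_f T i c)"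

fun aff_e :: "affine_type \<Rightarrow> nat \<Rightarrow> int \<times> young_class \<Rightarrow> (int \<times> young_class) option" where
  "aff_e T i (m, c) = map_option (\<lambda>c'. (m + (if i = 0 then 1 else 0), c')) (cl_e T i c)"


section \<open>Energy functions\<close>

definition extremal :: "affine_type \<Rightarrow> young_class \<Rightarrow> bool" where
  "extremal T c \<longleftrightarrow> (T = E8 \<longrightarrow> wt T c \<noteq> (\<lambda>_. 0))"

definition energy_function ::
    "affine_type \<Rightarrow> (young_class \<times> young_class \<Rightarrow> int) \<Rightarrow> bool" where
  "energy_function T H \<longleftrightarrow>
     (\<forall>b \<in> crystal T. \<forall>b' \<in> crystal T.
        (\<forall>i \<in> {1..rank T}. \<forall>x. tensor_f T i (b, b') = Some x \<longrightarrow> H x = H (b, b')) \<and>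
        (\<forall>a. cl_f T 0 b = Some a \<and> tensor_f T 0 (b, b') = Some (a, b') \<longrightarrow>
           H (a, b') = H (b, b') + 1) \<and>
        (\<forall>a'. cl_f T 0 b' = Some a' \<and> tensor_f T 0 (b, b') = Some (b, a') \<longrightarrow>
           H (b, a') = H (b, b') - 1)) \<and>
     (\<forall>c \<in> crystal T. extremal T c \<longrightarrow> H (c, c) = 0)"

fun H_aff ::
    "(young_class \<times> young_class \<Rightarrow> int) \<Rightarrow> int \<times> young_class \<Rightarrow> int \<times> young_class \<Rightarrow> int" where
  "H_aff H (m, a) (n, b) = H (a, b) + m - n"


section \<open>Young walls\<close>

fun wall_cube :: "affine_type \<Rightarrow> nat \<Rightarrow> int \<Rightarrow> cross_section" where
  "wall_cube E6 r k = cube E6 (k + 8 * int r)"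
| "wall_cube E7 r k = (if even r then cube E7 k else rot_section (cube E7 (k + 4)))"
| "wall_cube E8 r k = cube E8 k"

definition wall_pattern :: "affine_type \<Rightarrow> nat \<Rightarrow> block set" where
  "wall_pattern T r = (\<Union>k. cube_blocks k (wall_cube T r k))"

fun ground_top :: "affine_type \<Rightarrow> block \<Rightarrow> bool" where
  "ground_top E6 b \<longleftrightarrow>
     height b = 1 \<and> card (cells b) = 3 \<or>
     height b = 2 \<and> cells b = UNIV \<times> {2} \<or>
     height b = 3 \<and> card (cells b) = 1"
| "ground_top E7 b \<longleftrightarrow>
     height b = 1 \<and> card (cells b) \<noteq> 1 \<or>
     height b = 2 \<and> cells b = UNIV \<times> {2..3} \<or>
     height b = 3 \<and> UNIV \<times> {3} \<subseteq> cells b \<or>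
     height b = 4 \<and> cells b = UNIV \<times> {3} \<or>
     height b = 5 \<and> card (cells b) = 1"
| "ground_top E8 b \<longleftrightarrow>
     height b = 1 \<and> colour b \<in> {7, 5, 2} \<or>
     height b = 2 \<and> colour b \<in> {6, 4} \<or>
     height b = 3 \<and> colour b \<in> {5, 3} \<or>
     height b = 4 \<and> colour b \<in> {4, 1} \<or>
     height b = 5 \<and> colour b \<in> {2, 3} \<or>
     height b = 6 \<and> cells b = UNIV \<times> {4..6} \<or>
     height b = 7 \<and> colour b = 5 \<or>
     height b = 8 \<and> colour b = 6 \<or>
     height b = 9 \<and> colour b = 7 \<or>
     height b = 10 \<and> colour b = 8 \<or>
     height b = 11 \<and> colour b = 0"

definition ground_column :: "affine_type \<Rightarrow> nat \<Rightarrow> block set" where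
  "ground_column T r = {b \<in> wall_pattern T r. height b \<le> 0 \<or> ground_top T b}"

definition ground_class :: "affine_type \<Rightarrow> nat \<Rightarrow> young_class" where
  "ground_class T r = class_of T (ground_column T r)"

definition ground_degrees ::
    "affine_type \<Rightarrow> (young_class \<times> young_class \<Rightarrow> int) \<Rightarrow> (nat \<Rightarrow> int) \<Rightarrow> bool" where
  "ground_degrees T H m \<longleftrightarrow>
     m 0 = 0 \<and>
     (\<forall>r. H_aff H (m (Suc r), ground_class T (Suc r)) (m r, ground_class T r) = 1)"

text \<open>A wall is the function mapping \<open>r\<close> to its column \<open>r\<close>.\<close>

definition young_walls :: "affine_type \<Rightarrow> (nat \<Rightarrow> block set) set" where
  "young_walls T =
     {Y. (\<forall>r. Y r \<in> young_columns T (wall_pattern T r)) \<and>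
         finite {(r, b). b \<in> (Y r - ground_column T r) \<union> (ground_column T r - Y r)}}"

definition column_identification ::
    "affine_type \<Rightarrow> (nat \<Rightarrow> int) \<Rightarrow> nat \<Rightarrow> (block set \<Rightarrow> int \<times> young_class) \<Rightarrow> bool" where
  "column_identification T m r F \<longleftrightarrow>
     bij_betw F (young_columns T (wall_pattern T r)) (affinization T) \<and>
     (\<forall>Y \<in> young_columns T (wall_pattern T r). \<forall>i \<in> {0..rank T}.
        map_option F (col_f T (wall_pattern T r) i Y) = aff_f T i (F Y) \<and>
        map_option F (col_e T (wall_pattern T r) i Y) = aff_e T i (F Y)) \<and>
     F (ground_column T r) = (m r, ground_class T r)"

definition Z_Lambda0 ::
    "affine_type \<Rightarrow> (young_class \<times> young_class \<Rightarrow> int) \<Rightarrow>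
     (nat \<Rightarrow> block set \<Rightarrow> int \<times> young_class) \<Rightarrow> (nat \<Rightarrow> block set) set" where
  "Z_Lambda0 T H F =
     {Y \<in> young_walls T. \<forall>r. H_aff H (F (Suc r) (Y (Suc r))) (F r (Y r)) > 0}"

definition zero_diff :: "affine_type \<Rightarrow> nat \<Rightarrow> block set \<Rightarrow> int" where
  "zero_diff T r y =
     int (card {b \<in> y - ground_column T r. colour b = 0}) -
     int (card {b \<in> ground_column T r - y. colour b = 0})"

end

theory Submission
  imports Defs
begin

text \<open>
  The bijection between the Young columns of column \<open>r\<close> and the affinization lowers the exponent
  of \<open>z\<close> by one exactly when a \<open>0\<close>-block is added.  Hence the exponent of \<open>z\<close> plus the number of
  \<open>0\<close>-blocks relative to the ground state is constant along the operators, and once all Young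
  columns are connected to the ground state by the operators, \<open>n\<^sub>r = m\<^sub>r - |z\<^bsup>n\<^esup>y|\<^sub>0\<close>; the
  asserted equivalence is then arithmetic.

  For connectedness every Young column is taken down to the set of all blocks of height at most
  \<open>K\<close>, for some low \<open>K\<close>.  In types \<open>E6\<close> and \<open>E7\<close> any two blocks of one colour are comparable for
  the order ``must lie below'', so the operator for the colour of a highest block removes that
  block.  In type \<open>E8\<close> the few incomparable pairs of one colour lie symmetrically about the cubes
  of section \<open>444444\<close>; strings of length two arise from them and from the special columns, and
  the middle of a string needs a separate argument since the other operators annihilate it.
\<close>

section \<open>Tables of the patterns\<close>

text \<open>Comparability is decidable by evaluation because it is local: a block has every block at
  least \<open>depth T\<close> levels lower beneath it, so an incomparable pair fits into a window
  of bounded height, and periodicity leaves one window per table entry. The same fact gives every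
  ideal a full lower part, so a column and the ground state share some \<open>filled P K\<close>,
  with finitely many blocks above it. The computation bounds the order from one side: it lists
  blocks that certainly lie below a given one, and the checks on comparability speak of the
  remaining pairs, the gaps. In type E8 the arithmetic of heights carries the argument: translation
  by 10 combined with rotation preserves the pattern, the cubes \<open>444444\<close> have heights 6
  modulo 10, and these are the mean heights of incomparable blocks of one colour. Hence
  \<open>K\<close> is taken divisible by 10: the operators then do not reach into
  \<open>filled P8 K\<close> while blocks above it remain.\<close>

type_synonym level = "(nat \<times> nat list) list"

text \<open>Within its cube a block is named by its colour, except that \<open>9\<close> names the \<open>4\<close>-block over cell
  columns \<open>4\<close>--\<open>6\<close> of a cube \<open>444444\<close>.\<close>

definition colour_of :: "nat \<Rightarrow> nat" where
  "colour_of x = (if x = 9 then 4 else x)"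

fun names :: "cross_section \<Rightarrow> nat list" where
  "names x = (if x = (replicate 6 4, replicate 6 4) then [4, 9] else remdups (fst x @ snd x))"

fun row_cells :: "row \<Rightarrow> nat \<Rightarrow> nat \<Rightarrow> nat list \<Rightarrow> cell list" where
  "row_cells a i j [] = []"
| "row_cells a i j (c # w) = (if c = i then (a, j) # row_cells a i (Suc j) w else row_cells a i (Suc j) w)"

fun name_cells :: "cross_section \<Rightarrow> nat \<Rightarrow> cell list" where
  "name_cells x i =
    (if x = (replicate 6 4, replicate 6 4)
     then List.product [Upper, Lower] (if i = 4 then [1,2,3] else [4,5,6])
     else row_cells Upper i 1 (fst x) @ row_cells Lower i 1 (snd x))"

definition block_at :: "cross_section \<Rightarrow> int \<Rightarrow> nat \<Rightarrow> block" where
  "block_at c k x = Block k (set (name_cells c x)) (colour_of x)"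

text \<open>Entry \<open>i\<close> is cube \<open>i + 1\<close>: the names of its blocks, each with the names of those blocks of the
  next lower cube on which it rests.  The tables are cyclic, and one of them serves both columns
  of type \<open>E7\<close> because rotation preserves the relation of resting on.\<close>

fun table :: "affine_type \<Rightarrow> level list" where
  "table E6 =
    [[(4,[2,3]), (0,[2])],
     [(2,[4,0]), (5,[4])],
     [(4,[2,5]), (6,[5])],
     [(3,[4]), (5,[4,6])],
     [(4,[3,5]), (1,[3])],
     [(3,[4,1]), (2,[4])],
     [(4,[3,2]), (0,[2])],
     [(5,[4]), (2,[4,0])],
     [(4,[5,2]), (6,[5])],
     [(5,[4,6]), (3,[4])],
     [(4,[5,3]), (1,[3])],
     [(2,[4]), (3,[4,1])]]"
| "table E7 =
    [[(3,[1,4]), (2,[4]), (0,[1])],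
     [(1,[3,0]), (4,[3,2])],
     [(3,[1,4]), (5,[4])],
     [(4,[3,5]), (6,[5])],
     [(2,[4]), (5,[4,6]), (7,[6])],
     [(4,[2,5]), (6,[5,7])],
     [(3,[4]), (5,[4,6])],
     [(1,[3]), (4,[3,5])]]"
| "table E8 =
    [[(7,[8,6]), (5,[6,4]), (2,[4]), (0,[8])],
     [(8,[7,0]), (6,[7,5]), (4,[5,2])],
     [(7,[8,6]), (5,[6,4]), (3,[4])],
     [(6,[7,5]), (4,[5,3]), (1,[3])],
     [(5,[6,4]), (2,[4]), (3,[4,1])],
     [(4,[5,2]), (9,[2,3])],
     [(3,[4]), (2,[4,9]), (5,[9])],
     [(1,[3]), (4,[3,2,5]), (6,[5])],
     [(3,[1,4]), (5,[4,6]), (7,[6])],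
     [(4,[3,5]), (6,[5,7]), (8,[7])],
     [(2,[4]), (5,[4,6]), (7,[6,8]), (0,[8])],
     [(4,[2,5]), (6,[5,7]), (8,[7,0])],
     [(3,[4]), (5,[4,6]), (7,[6,8])],
     [(1,[3]), (4,[3,5]), (6,[5,7])],
     [(3,[1,4]), (2,[4]), (5,[4,6])],
     [(4,[3,2]), (9,[2,5])],
     [(5,[4]), (2,[4,9]), (3,[9])],
     [(6,[5]), (4,[5,2,3]), (1,[3])],
     [(7,[6]), (5,[6,4]), (3,[4,1])],
     [(8,[7]), (6,[7,5]), (4,[5,3])]]"

text \<open>In types E6 and E8 the rotated cubes complete the period and serve all columns. The E7
  pattern has period 8 already; there \<open>\<rho>\<close> selects the rotated cubes of the odd
  columns.\<close>

fun sections :: "affine_type \<Rightarrow> bool \<Rightarrow> cross_section list" where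
  "sections E7 \<rho> = (if \<rho> then map rot_section (base_cubes E7) else base_cubes E7)"
| "sections T \<rho> = base_cubes T @ map rot_section (base_cubes T)"

definition support :: "cross_section \<Rightarrow> cross_section \<Rightarrow> nat \<Rightarrow> nat list" where
  "support c c' x = filter (\<lambda>y. list_ex (List.member (name_cells c' y)) (name_cells c x)) (names c')"

text \<open>The first argument is the cube just below the head of the list; starting with the last
  cube closes the cycle. One inclusion suffices for the supports: one missing from the table could
  only enlarge the lists of gaps.\<close>

fun fits :: "cross_section \<Rightarrow> cross_section list \<Rightarrow> level list \<Rightarrow> bool" where
  "fits c [] [] = True"
| "fits c (d # ds) (l # ls) =
     (set (names d) = set (map fst l) \<and> list_all (\<lambda>(x, S). set S \<subseteq> set (support d c x)) l \<and> fits d ds ls)"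
| "fits c _ _ = False"

lemma fits_E6: "fits (last (sections E6 \<rho>)) (sections E6 \<rho>) (table E6)" by code_simp
lemma fits_E7: "fits (last (sections E7 \<rho>)) (sections E7 \<rho>) (table E7)"
  by (cases \<rho>) (simp_all only:, code_simp+)
lemma fits_E8: "fits (last (sections E8 \<rho>)) (sections E8 \<rho>) (table E8)" by code_simp

section \<open>Blocks forced below a given block, and the finite checks\<close>

fun merge :: "nat list \<Rightarrow> nat list \<Rightarrow> nat list" where
  "merge [] Y = Y"
| "merge (x # X) Y = (if x \<in> set Y then merge X Y else x # merge X Y)"

fun down :: "nat list \<Rightarrow> level \<Rightarrow> nat list" where
  "down X [] = []"
| "down X ((x, S) # l) = (if x \<in> set X then merge S (down X l) else down X l)"

text \<open>\<open>gaps n X [l\<^sub>0, l\<^sub>1, \<dots>]\<close> lists the \<open>(n + i, y)\<close> for which the block \<open>y\<close> of \<open>l\<^sub>i\<close> is not among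
  the blocks that must lie below the blocks \<open>X\<close> of \<open>l\<^sub>0\<close>.\<close>

fun missing :: "nat \<Rightarrow> nat list \<Rightarrow> level \<Rightarrow> (nat \<times> nat) list" where
  "missing n X [] = []"
| "missing n X ((x, S) # l) = (if x \<in> set X then missing n X l else (n, x) # missing n X l)"

fun gaps :: "nat \<Rightarrow> nat list \<Rightarrow> level list \<Rightarrow> (nat \<times> nat) list" where
  "gaps n X [] = []"
| "gaps n X (l # ls) = missing n X l @ gaps (Suc n) (down X l) ls"

text \<open>\<open>P k\<close> sees the descending list headed by the \<open>k\<close>-th table
  entry, counted from 1, for every entry of the topmost period.\<close>

fun down_all :: "(nat \<Rightarrow> level list \<Rightarrow> bool) \<Rightarrow> nat \<Rightarrow> level list \<Rightarrow> bool" where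
  "down_all P 0 W = True"
| "down_all P (Suc k) W = (P (Suc k) W \<and> down_all P k (tl W))"

fun all_names :: "(level list \<Rightarrow> nat \<Rightarrow> bool) \<Rightarrow> level list \<Rightarrow> nat list \<Rightarrow> bool" where
  "all_names P W [] = True"
| "all_names P W (x # xs) = (P W x \<and> all_names P W xs)"

fun full_ok :: "nat \<Rightarrow> level list \<Rightarrow> nat \<Rightarrow> bool" where
  "full_ok d W x = list_all (\<lambda>(n, y). n \<noteq> d) (gaps 0 [x] (take (Suc d) W))"

fun cover_ok :: "level list \<Rightarrow> nat \<Rightarrow> bool" where
  "cover_ok (l # W) y = list_ex (\<lambda>(x, S). List.member S y) l"
| "cover_ok [] y = False"

fun chain_ok :: "nat \<Rightarrow> level list \<Rightarrow> nat \<Rightarrow> bool" where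
  "chain_ok d W x = list_all (\<lambda>(n, y). colour_of x \<noteq> colour_of y) (gaps 0 [x] (take (Suc d) W))"

text \<open>\<open>k - n div 2\<close> is the mean height of the pair modulo the period, so the
  congruence says that a cube \<open>444444\<close> lies midway; adding 20 avoids truncated
  subtraction.\<close>

fun pairs_ok :: "nat \<Rightarrow> nat \<Rightarrow> level list \<Rightarrow> nat \<Rightarrow> bool" where
  "pairs_ok d k W x = list_all (\<lambda>(n, y). colour_of x = colour_of y \<longrightarrow>
         colour_of x \<noteq> 2 \<and> even n \<and> (k + 20 - n div 2) mod 10 = 6 \<and> n \<le> 10 \<and> (colour_of x = 4 \<longleftrightarrow> n = 0))
       (gaps 0 [x] (take (Suc d) W))"

text \<open>Excludes a triple in which \<open>y\<close> is a gap of the top block, \<open>z\<close>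
  of the same colour is a gap of \<open>y\<close>, and \<open>z\<close> is a gap of the top block
  too. Numbering the gaps of \<open>y\<close> from \<open>n\<close> measures both depths from the
  top block, so that they can be looked up in \<open>G\<close>.\<close>

fun separated :: "nat \<Rightarrow> (nat \<times> nat) list \<Rightarrow> level list \<Rightarrow> (nat \<times> nat) list \<Rightarrow> bool" where
  "separated d G W [] = True"
| "separated d G W ((n, y) # N) =
    (list_all (\<lambda>(m, z). colour_of y = colour_of z \<longrightarrow> \<not> List.member G (m, z))
       (gaps n [y] (take (Suc d) (drop n W))) \<and> separated d G W N)"

fun separated_at :: "nat \<Rightarrow> level list \<Rightarrow> (nat \<times> nat) list \<Rightarrow> bool" where
  "separated_at d W G = separated d G W G"

fun triples_ok :: "nat \<Rightarrow> level list \<Rightarrow> nat \<Rightarrow> bool" where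
  "triples_ok d W x = separated_at d W (gaps 0 [x] (take (Suc d) W))"

fun level_ok :: "(level list \<Rightarrow> nat \<Rightarrow> bool) \<Rightarrow> level list \<Rightarrow> bool" where
  "level_ok P [] = False"
| "level_ok P (l # W) = all_names P (l # W) (map fst l)"

fun covered :: "level list \<Rightarrow> bool" where
  "covered (l # l' # W) = all_names cover_ok (l # W) (map fst l')"
| "covered _ = False"

text \<open>Three periods make every window used below a contiguous sublist.\<close>

definition descending :: "affine_type \<Rightarrow> level list" where
  "descending T = rev (table T) @ rev (table T) @ rev (table T)"

text \<open>The smallest depth at which every block has all blocks of the pattern below it.\<close>

fun depth :: "affine_type \<Rightarrow> nat" where
  "depth E6 = 3" | "depth E7 = 5" | "depth E8 = 11"

lemma full_check:
  "down_all (\<lambda>_. level_ok (full_ok (depth T))) (length (table T)) (descending T)"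
  by (cases T; simp only:; code_simp)

lemma cover_check: "down_all (\<lambda>_. covered) (length (table T)) (descending T)"
  by (cases T; simp only:; code_simp)

lemma chain_check:
  assumes "T \<noteq> E8"
  shows "down_all (\<lambda>_. level_ok (chain_ok (depth T))) (length (table T)) (descending T)"
  using assms by (cases T; simp only:; code_simp?) simp?

lemma pairs_check:
  "down_all (\<lambda>k. level_ok (pairs_ok 11 k)) (length (table E8)) (descending E8)"
  by code_simp

lemma triples_check:
  "down_all (\<lambda>_. level_ok (triples_ok 11)) (length (table E8)) (descending E8)"
  by code_simp

section \<open>The order of resting on one another\<close>

definition below :: "block set \<Rightarrow> (block \<times> block) set" where
  "below P = {(b', b). b \<in> P \<and> b' \<in> P \<and> height b' = height b - 1 \<and> cells b' \<inter> cells b \<noteq> {}}"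

abbreviation le :: "block set \<Rightarrow> block \<Rightarrow> block \<Rightarrow> bool" where
  "le P b c \<equiv> (b, c) \<in> (below P)\<^sup>*"

section \<open>From cross-sections to named blocks\<close>

lemma set_row_cells: "set (row_cells a i j w) = {(a, j + t) | t. t < length w \<and> w ! t = i}"
proof (induction w arbitrary: j)
  case (Cons c w)
  have ex: "(\<exists>t. Q t) \<longleftrightarrow> Q 0 \<or> (\<exists>t. Q (Suc t))" for Q :: "nat \<Rightarrow> bool"
    by (metis not0_implies_Suc)
  have *: "{(a, j + t) | t. t < length (c # w) \<and> (c # w) ! t = i} =
     (if c = i then {(a, j)} else {}) \<union> {(a, Suc j + t) | t. t < length w \<and> w ! t = i}"
    by (subst ex) auto
  show ?case unfolding * by (simp add: Cons.IH)
qed simp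

lemma region_eq: "region (u, l) i = set (row_cells Upper i 1 u) \<union> set (row_cells Lower i 1 l)"
proof -
  have *: "{(a, j) | j. 1 \<le> j \<and> j \<le> length w \<and> w ! (j - 1) = i} = set (row_cells a i 1 w)" for a w
  proof -
    have "\<exists>t. j = Suc t \<and> t < length w \<and> w ! t = i"
      if "1 \<le> j" "j \<le> length w" "w ! (j - 1) = i" for j
      using that by (cases j) auto
    then show ?thesis unfolding set_row_cells by auto
  qed
  show ?thesis unfolding region.simps * ..
qed

text \<open>As 9 is the name of the second 4-block, it must not occur as a colour.\<close>

lemma cube_blocks_eq:
  assumes "9 \<notin> set (fst x) \<union> set (snd x)"
  shows "cube_blocks k x = block_at x k ` set (names x)"
proof (cases "x = (replicate 6 4, replicate 6 4)")
  case True
  have "(UNIV :: row set) = {Upper, Lower}" using row.exhaust by blast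
  moreover have "{1..3::nat} = {1, 2, 3}" "{4..6::nat} = {4, 5, 6}" by auto
  ultimately have *: "UNIV \<times> {1..3::nat} = set (List.product [Upper, Lower] [1, 2, 3])"
    "UNIV \<times> {4..6::nat} = set (List.product [Upper, Lower] [4, 5, 6])"
    by auto
  show ?thesis unfolding cube_blocks_def True *
    by (simp add: block_at_def colour_of_def insert_commute)
next
  case False
  obtain u l where x: "x = (u, l)" by (cases x)
  have "{Block k (region x i) i | i. region x i \<noteq> {}} = (\<lambda>i. Block k (region x i) i) ` (set u \<union> set l)"
  proof -
    have "region (u, l) i \<noteq> {} \<longleftrightarrow> i \<in> set u \<union> set l" for i
      unfolding region_eq set_row_cells by (auto simp: in_set_conv_nth)
    then show ?thesis unfolding x by blast
  qed
  also have "\<dots> = block_at x k ` set (names x)"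
  proof (rule image_cong)
    show "set u \<union> set l = set (names x)" using False x by auto
    fix i assume "i \<in> set (names x)"
    then have "i \<noteq> 9" using False assms x by auto
    then show "Block k (region x i) i = block_at x k i"
      using False by (auto simp: x block_at_def colour_of_def region_eq simp del: region.simps)
  qed
  finally show ?thesis using False by (simp add: cube_blocks_def)
qed

text \<open>In \<open>(c # ds) ! i\<close> the list is shifted by one: this is the cube below
  \<open>ds ! i\<close>.\<close>

lemma fits_nth:
  assumes "fits c ds ls"
  shows "length ds = length ls"
    and "i < length ls \<Longrightarrow> set (names (ds ! i)) = fst ` set (ls ! i)"
    and "i < length ls \<Longrightarrow> (x, S) \<in> set (ls ! i) \<Longrightarrow> set S \<subseteq> set (support (ds ! i) ((c # ds) ! i) x)"
  using assms
proof (induction c ds ls arbitrary: i rule: fits.induct)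
  case (2 c d ds l ls)
  {
    case 1 then show ?case using 2 by simp
  next
    case 2 then show ?case using "2.IH"(2)[of "i - 1"] by (cases i) auto
  next
    case 3 then show ?case using "2.IH"(3)[of "i - 1"] by (cases i) (auto simp: list_all_iff)
  }
qed auto

lemma support_meets:
  assumes "y \<in> set (support d c x)"
  shows "y \<in> set (names c)" "cells (block_at c k y) \<inter> cells (block_at d k' x) \<noteq> {}"
  using assms by (auto simp: support_def list_ex_iff block_at_def)

text \<open>One column of a wall seen through its table: \<open>s\<close> aligns heights with table
  positions, \<open>bl k x\<close> is the block named \<open>x\<close> in cube \<open>k\<close>. All
  types and all columns, shifted or rotated, share the development in this form.\<close>

locale level_table =
  fixes T :: affine_type and P :: "block set" and s :: int
    and lev :: "int \<Rightarrow> level" and bl :: "int \<Rightarrow> nat \<Rightarrow> block"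
  assumes lev_eq: "\<And>k. lev k = table T ! nat ((k + s) mod int (length (table T)))"
    and P_eq: "P = {bl k x | k x. x \<in> fst ` set (lev k)}"
    and height_bl [simp]: "\<And>k x. height (bl k x) = k"
    and colour_bl [simp]: "\<And>k x. colour (bl k x) = colour_of x"
    and support: "\<And>k x S y. (x, S) \<in> set (lev k) \<Longrightarrow> y \<in> set S \<Longrightarrow>
      y \<in> fst ` set (lev (k - 1)) \<and> cells (bl (k - 1) y) \<inter> cells (bl k x) \<noteq> {}"
begin

lemma table_nonempty: "length (table T) > 0" by (cases T) auto

lemma blI: "x \<in> fst ` set (lev k) \<Longrightarrow> bl k x \<in> P"
  by (auto simp: P_eq)

lemma blE:
  assumes "b \<in> P"
  obtains x where "x \<in> fst ` set (lev (height b))" "b = bl (height b) x"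
proof -
  from assms obtain k x where "b = bl k x" "x \<in> fst ` set (lev k)" unfolding P_eq by blast
  then show thesis by (intro that[of x]) simp_all
qed

lemma below_bl: "(x, S) \<in> set (lev k) \<Longrightarrow> y \<in> set S \<Longrightarrow> (bl (k - 1) y, bl k x) \<in> below P"
  using support[of x S k y] by (force simp: below_def intro: blI)

definition window :: "int \<Rightarrow> nat \<Rightarrow> level list" where
  "window k n = map (\<lambda>i. lev (k - int i)) [0..<n]"

lemma window_Suc: "window k (Suc n) = lev k # window (k - 1) n"
  unfolding window_def upt_conv_Cons[OF zero_less_Suc] map_Suc_upt[symmetric] list.map map_map
  by (simp add: comp_def algebra_simps)

lemma set_missing: "(n, y) \<in> set (missing m X l) \<longleftrightarrow> n = m \<and> y \<in> fst ` set l - set X"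
  by (induction m X l rule: missing.induct) auto

lemma set_merge: "set (merge X Y) = set X \<union> set Y"
  by (induction X Y rule: merge.induct) auto

lemma set_down: "y \<in> set (down X l) \<longleftrightarrow> (\<exists>x S. (x, S) \<in> set l \<and> x \<in> set X \<and> y \<in> set S)"
  by (induction X l rule: down.induct) (auto simp: set_merge)

text \<open>The list handed from level to level consists of blocks already known to lie below
  \<open>b\<close>; whatever is not reported as a gap belongs to it.\<close>

lemma gaps_sound:
  assumes "\<And>x. x \<in> set X \<Longrightarrow> le P (bl k x) b"
    and "i < n" and "y \<in> fst ` set (lev (k - int i))"
    and "(m + i, y) \<notin> set (gaps m X (window k n))"
  shows "le P (bl (k - int i) y) b"
  using assms
proof (induction n arbitrary: X k m i)
  case (Suc n)
  show ?case
  proof (cases i)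
    case 0
    then have "y \<in> set X" using Suc.prems(3,4) by (auto simp: window_Suc set_missing)
    then show ?thesis using Suc.prems(1) 0 by simp
  next
    case (Suc j)
    have "le P (bl (k - 1 - int j) y) b"
    proof (rule Suc.IH[where m = "Suc m" and X = "down X (lev k)"])
      fix x assume "x \<in> set (down X (lev k))"
      then obtain x' S where "(x', S) \<in> set (lev k)" "x' \<in> set X" "x \<in> set S" by (auto simp: set_down)
      then show "le P (bl (k - 1) x) b"
        using below_bl[of x' S k x] Suc.prems(1)[of x'] by (meson converse_rtrancl_into_rtrancl)
    qed (use Suc.prems Suc in \<open>auto simp: window_Suc algebra_simps\<close>)
    then show ?thesis using Suc by (simp add: algebra_simps)
  qed
qed simp

lemma gap:
  assumes "b = bl k x" and "i < n" and "y \<in> fst ` set (lev (k - int i))"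
    and "\<not> le P (bl (k - int i) y) b"
  shows "(m + i, y) \<in> set (gaps m [x] (window k n))"
  using gaps_sound[of "[x]" k b i n y m] assms by auto

lemma down_allD:
  "down_all Q n W \<Longrightarrow> q < n \<Longrightarrow> Q (Suc q) (drop (n - Suc q) W)"
proof (induction n arbitrary: W)
  case (Suc n)
  show ?case
  proof (cases "q = n")
    case False
    then have "Suc n - Suc q = Suc (n - Suc q)" using Suc.prems(2) by simp
    then show ?thesis using Suc False by (simp only: drop_Suc) simp
  qed (use Suc.prems in simp)
qed simp

lemma descending_nth:
  assumes "t < 3 * length (table T)"
  shows "descending T ! t = table T ! nat ((- 1 - int t) mod int (length (table T)))"
proof -
  let ?p = "length (table T)"
  have "descending T ! t = rev (table T) ! (t mod ?p)"
  proof -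
    consider "t < ?p" | "?p \<le> t" "t < 2 * ?p" | "2 * ?p \<le> t" by linarith
    then show ?thesis
    proof cases
      case 2
      then have "t mod ?p = t - ?p" by (simp add: mod_if)
      with 2 show ?thesis by (simp add: descending_def nth_append)
    next
      case 3
      then have "\<not> t < ?p" "\<not> t - ?p < ?p" "t - ?p - ?p < ?p" using assms by linarith+
      then have "t mod ?p = t - ?p - ?p"
        "descending T ! t = rev (table T) ! (t - ?p - ?p)"
        by (simp_all add: descending_def nth_append le_mod_geq)
      then show ?thesis by (simp only:)
    qed (simp add: descending_def nth_append)
  qed
  also have "\<dots> = table T ! (?p - 1 - t mod ?p)"
    using table_nonempty by (simp add: rev_nth)
  also have "?p - 1 - t mod ?p = nat ((- 1 - int t) mod int ?p)"
  proof -
    have "- 1 - int t = (int ?p - 1 - int (t mod ?p)) + int ?p * (- 1 - int (t div ?p))"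
    proof -
      have "int t = int ?p * int (t div ?p) + int (t mod ?p)"
        by (metis mult_div_mod_eq of_nat_add of_nat_mult)
      then show ?thesis by (simp only: algebra_simps)
    qed
    then have "(- 1 - int t) mod int ?p = (int ?p - 1 - int (t mod ?p)) mod int ?p"
      by (simp only: mod_mult_self2)
    also have "\<dots> = int ?p - 1 - int (t mod ?p)"
      using table_nonempty mod_less_divisor[OF table_nonempty, of t]
      by (intro mod_pos_pos_trivial) linarith+
    finally show ?thesis using table_nonempty by linarith
  qed
  finally show ?thesis .
qed

text \<open>Dropping less than one period aligns the list with height \<open>k\<close>. More than
  two of its three periods remain, whence the bound on \<open>i + n\<close>.\<close>

lemma window_eq:
  assumes "i + n \<le> 2 * length (table T)"
  shows "take n (drop i (drop (length (table T) - Suc (nat ((k + s) mod int (length (table T))))) (descending T)))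
    = window (k - int i) n" (is "take n (drop i (drop ?t _)) = _")
proof (rule nth_equalityI)
  let ?p = "length (table T)" let ?q = "(k + s) mod int (length (table T))"
  have q: "0 \<le> ?q" "?q < int ?p" using table_nonempty by auto
  have len: "length (descending T) = 3 * ?p" by (simp add: descending_def)
  show "length (take n (drop i (drop ?t (descending T)))) = length (window (k - int i) n)"
    using assms len q by (simp add: window_def)
  fix j assume "j < length (take n (drop i (drop ?t (descending T))))"
  then have j: "j < n" by simp
  then have lt: "?t + (i + j) < 3 * ?p" using assms q by linarith
  have "take n (drop i (drop ?t (descending T))) ! j = descending T ! (?t + (i + j))"
    using j lt len by (simp add: ac_simps)
  also have "\<dots> = table T ! nat ((- 1 - int (?t + (i + j))) mod int ?p)"
    by (rule descending_nth[OF lt])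
  also have "- 1 - int (?t + (i + j)) = ?q - int i - int j - int ?p"
    using q by (simp add: of_nat_diff)
  also have "(?q - int i - int j - int ?p) mod int ?p = (?q - int i - int j) mod int ?p"
    by (rule minus_mod_self2)
  also have "\<dots> = (k - int i - int j + s) mod int ?p"
    unfolding diff_diff_eq mod_diff_left_eq by (simp add: algebra_simps)
  also have "table T ! nat \<dots> = window (k - int i) n ! j"
    using j by (simp add: window_def lev_eq)
  finally show "take n (drop i (drop ?t (descending T))) ! j = window (k - int i) n ! j" .
qed

lemma all_namesD: "all_names Q W xs \<Longrightarrow> x \<in> set xs \<Longrightarrow> Q W x"
  by (induction Q W xs rule: all_names.induct) auto

text \<open>Transfers a check over one period to an arbitrary height: \<open>W\<close> is the list
  starting at the table position of height \<open>k\<close>.\<close>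

lemma check_level:
  assumes "down_all Q (length (table T)) (descending T)"
  obtains W where "Q (Suc (nat ((k + s) mod int (length (table T))))) W"
    and "\<And>i n. i + n \<le> 2 * length (table T) \<Longrightarrow> take n (drop i W) = window (k - int i) n"
proof -
  have "nat ((k + s) mod int (length (table T))) < length (table T)"
    using table_nonempty by (simp add: nat_less_iff)
  from down_allD[OF assms this] show ?thesis using that window_eq by blast
qed

lemma level_okD:
  assumes "level_ok Q W" and "take 1 W = window k 1" and "x \<in> fst ` set (lev k)"
  shows "Q W x"
proof -
  from assms(1,2) obtain V where W: "W = lev k # V" by (cases W) (auto simp: window_def)
  show ?thesis using all_namesD[of Q W "map fst (lev k)" x] assms(1,3) W by simp
qed

lemma depth_le: "Suc (depth T) \<le> length (table T)" by (cases T) auto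

lemma full:
  assumes "b \<in> P" "c \<in> P" "height c = height b - int (depth T)"
  shows "le P c b"
proof -
  obtain x where x: "x \<in> fst ` set (lev (height b))" "b = bl (height b) x" by (rule blE[OF assms(1)])
  obtain y where y: "y \<in> fst ` set (lev (height c))" "c = bl (height c) y" by (rule blE[OF assms(2)])
  obtain W where W: "level_ok (full_ok (depth T)) W"
    "\<And>i n. i + n \<le> 2 * length (table T) \<Longrightarrow> take n (drop i W) = window (height b - int i) n"
    by (rule check_level[OF full_check, of "height b"]) blast
  have "full_ok (depth T) W x"
    by (rule level_okD[OF W(1) _ x(1)]) (use W(2)[of 0 1] table_nonempty in simp)
  then have "(0 + depth T, y) \<notin> set (gaps 0 [x] (window (height b) (Suc (depth T))))"
    using W(2)[of 0 "Suc (depth T)"] depth_le by (auto simp: list_all_iff)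
  then show ?thesis using gap[of b "height b" x "depth T" _ y 0] x y assms(3) by auto
qed

lemma cover:
  assumes "c \<in> P"
  shows "\<exists>b \<in> P. height b = height c + 1 \<and> (c, b) \<in> below P"
proof -
  let ?k = "height c + 1"
  obtain y where y: "y \<in> fst ` set (lev (height c))" "c = bl (height c) y" by (rule blE[OF assms])
  obtain W where W: "covered W"
    "\<And>i n. i + n \<le> 2 * length (table T) \<Longrightarrow> take n (drop i W) = window (?k - int i) n"
    by (rule check_level[OF cover_check, of ?k]) blast
  have "take 2 W = [lev ?k, lev (height c)]"
    using W(2)[of 0 2] table_nonempty by (simp add: window_def numeral_2_eq_2)
  then obtain V where "W = lev ?k # lev (height c) # V"
    by (cases W; cases "tl W") (auto simp: numeral_2_eq_2)
  with W(1) y(1) have "cover_ok (lev ?k # V) y"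
    using all_namesD[of cover_ok "lev ?k # V" "map fst (lev (height c))" y] by simp
  then obtain x S where x: "(x, S) \<in> set (lev ?k)" "y \<in> set S" by (auto simp: list_ex_iff)
  then have "(c, bl ?k x) \<in> below P" using below_bl[OF x] y by simp
  then show ?thesis by (intro bexI[of _ "bl ?k x"]) (simp_all add: below_def)
qed

lemma finite_level: "finite {b \<in> P. height b = k}"
proof (rule finite_subset)
  show "{b \<in> P. height b = k} \<subseteq> bl k ` fst ` set (lev k)" by (force simp: P_eq)
qed simp

lemma level_nonempty: "\<exists>b \<in> P. height b = k"
proof -
  have "\<forall>l \<in> set (table T). l \<noteq> []" by (cases T) auto
  then have "lev k \<noteq> []" using table_nonempty by (simp add: lev_eq nat_less_iff)
  then obtain e where "e \<in> set (lev k)" by (meson list.set_sel(1))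
  then show ?thesis by (intro bexI[of _ "bl k (fst e)"] blI) auto
qed

lemma colour_le_rank:
  assumes "b \<in> P"
  shows "colour b \<le> rank T"
proof -
  obtain x where x: "x \<in> fst ` set (lev (height b))" "b = bl (height b) x" by (rule blE[OF assms])
  have "\<forall>l \<in> set (table T). \<forall>e \<in> set l. colour_of (fst e) \<le> rank T"
    by (cases T) (auto simp: colour_of_def)
  moreover have "lev (height b) \<in> set (table T)" using table_nonempty by (simp add: lev_eq nat_less_iff)
  ultimately show ?thesis using x by auto (metis colour_bl fst_conv)
qed

text \<open>The check concerns depth exactly \<open>depth T\<close>; from a deeper \<open>c\<close>
  one climbs by \<open>cover\<close> until that depth is reached.\<close>

lemma full_le:
  assumes "b \<in> P" "c \<in> P" "height c \<le> height b - int (depth T)"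
  shows "le P c b"
  using assms(2,3)
proof (induction "nat (height b - int (depth T) - height c)" arbitrary: c)
  case 0
  then show ?case using full[OF assms(1)] by simp
next
  case (Suc n)
  obtain c' where c': "c' \<in> P" "height c' = height c + 1" "(c, c') \<in> below P"
    using cover[OF Suc.prems(1)] by blast
  have "le P c' b" using Suc.hyps(1)[of c'] Suc.hyps(2) Suc.prems c' by simp
  with c'(3) show ?case by (rule converse_rtrancl_into_rtrancl)
qed

text \<open>By \<open>full_le\<close> a pair violating the order is less than \<open>depth T\<close>
  levels apart, hence it appears as a gap inside the checked window.\<close>

lemma check_gaps:
  assumes "down_all (\<lambda>k. level_ok (Q k)) (length (table T)) (descending T)"
    and "b \<in> P" "c \<in> P" "height c \<le> height b" "\<not> le P c b"
  obtains W x y where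
    "Q (Suc (nat ((height b + s) mod int (length (table T))))) W x"
    "colour b = colour_of x" "colour c = colour_of y"
    "(nat (height b - height c), y) \<in> set (gaps 0 [x] (take (Suc (depth T)) W))"
proof -
  obtain x where x: "x \<in> fst ` set (lev (height b))" "b = bl (height b) x" by (rule blE[OF assms(2)])
  obtain y where y: "y \<in> fst ` set (lev (height c))" "c = bl (height c) y" by (rule blE[OF assms(3)])
  obtain W where W: "level_ok (Q (Suc (nat ((height b + s) mod int (length (table T)))))) W"
    "\<And>i n. i + n \<le> 2 * length (table T) \<Longrightarrow> take n (drop i W) = window (height b - int i) n"
    by (rule check_level[OF assms(1), of "height b"]) blast
  define n where "n = nat (height b - height c)"
  have n: "n < depth T" using full_le[OF assms(2,3)] assms(4,5) unfolding n_def by linarith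
  have c: "height c = height b - int n" using assms(4) by (simp add: n_def)
  have "(0 + n, y) \<in> set (gaps 0 [x] (window (height b) (Suc (depth T))))"
    by (rule gap[of b]) (use x y assms(5) n c in auto)
  moreover have "take (Suc (depth T)) W = window (height b) (Suc (depth T))"
    using W(2)[of 0 "Suc (depth T)"] depth_le by simp
  moreover have "Q (Suc (nat ((height b + s) mod int (length (table T))))) W x"
    by (rule level_okD[OF W(1) _ x(1)]) (use W(2)[of 0 1] table_nonempty in simp)
  ultimately show thesis
    using x(2) y(2) by (intro that[of W x y]) (simp_all add: n_def, (metis colour_bl)+)
qed

lemma chain:
  assumes "T \<noteq> E8" "b \<in> P" "c \<in> P" "colour b = colour c"
  shows "le P b c \<or> le P c b"
proof -
  have *: "le P c b" if bc: "b \<in> P" "c \<in> P" "colour b = colour c" "height c \<le> height b" for b c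
  proof (rule ccontr)
    assume "\<not> le P c b"
    then obtain W x y where "chain_ok (depth T) W x" "colour_of x = colour_of y"
      "(nat (height b - height c), y) \<in> set (gaps 0 [x] (take (Suc (depth T)) W))"
      using check_gaps[OF chain_check[OF assms(1)] bc(1,2,4)] bc(3) by metis
    then show False by (auto simp: list_all_iff)
  qed
  show ?thesis using *[of b c] *[of c b] assms by (cases "height c \<le> height b") auto
qed

end

locale E8_table = level_table E8 P "- 1" lev bl for P lev bl
begin

text \<open>The \<open>u\<close> of the last claim locates the cube \<open>444444\<close> at height
  \<open>6 + u\<close>, the mean of the two heights.\<close>

lemma pairs:
  assumes "b \<in> P" "c \<in> P" "colour b = colour c" "height c \<le> height b" "\<not> le P c b"
  shows "colour b \<noteq> 2" "height b \<le> height c + 10" "colour b = 4 \<longleftrightarrow> height b = height c"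
    "\<exists>u. 10 dvd u \<and> height b + height c = 12 + 2 * u"
proof -
  let ?q = "nat ((height b - 1) mod 20)"
  define n where "n = nat (height b - height c)"
  obtain W x y where "pairs_ok 11 (Suc (nat ((height b + - 1) mod int (length (table E8))))) W x"
    "colour b = colour_of x" "colour c = colour_of y"
    "(n, y) \<in> set (gaps 0 [x] (take (Suc (depth E8)) W))"
    using check_gaps[OF pairs_check assms(1,2,4,5)] unfolding n_def by metis
  then have *: "colour b \<noteq> 2 \<and> even n \<and> (Suc ?q + 20 - n div 2) mod 10 = 6 \<and> n \<le> 10 \<and> (colour b = 4 \<longleftrightarrow> n = 0)"
    using assms(3) by (auto simp: list_all_iff)
  then show "colour b \<noteq> 2" "height b \<le> height c + 10" "colour b = 4 \<longleftrightarrow> height b = height c"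
    using * assms(4) by (auto simp: n_def)
  obtain h where h: "n = 2 * h" using * by (auto elim: evenE)
  then have hh: "height b - height c = 2 * int h" using n_def assms(4) by linarith
  have "int ((Suc ?q + 20 - h) mod 10) = 6" using * h by simp
  moreover have "h \<le> 20" using * h by simp
  ultimately have "(1 + (height b - 1) mod 20 + 20 - int h) mod 10 = 6"
    by (simp add: zmod_int of_nat_diff)
  moreover obtain d where "(height b - 1) mod 20 = height b - 1 - 20 * d"
    by (metis minus_mult_div_eq_mod)
  ultimately have "(height b + 20 - 20 * d - int h) mod 10 = 6" by (simp add: algebra_simps)
  then have "10 dvd (height b - int h - 6)" by presburger
  then show "\<exists>u. 10 dvd u \<and> height b + height c = 12 + 2 * u"
    using hh by (intro exI[of _ "height b - int h - 6"]) simp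
qed

lemma separated_D:
  "separated d G W N \<Longrightarrow> (n, y) \<in> set N \<Longrightarrow> (m, z) \<in> set (gaps n [y] (take (Suc d) (drop n W))) \<Longrightarrow>
    colour_of y = colour_of z \<Longrightarrow> (m, z) \<notin> set G"
  by (induction d G W N rule: separated.induct) (auto simp: list_all_iff)

text \<open>Here \<open>b\<close> has any colour. This is the fact that refutes middle elements: a
  block \<open>b\<close> at least as high as \<open>c\<close> has one of \<open>a\<close>,
  \<open>c\<close> below it.\<close>

lemma triples:
  assumes "b \<in> P" "c \<in> P" "a \<in> P" "colour a = colour c" "height a \<le> height c" "height c \<le> height b"
    and "\<not> le P a c" "\<not> le P c b"
  shows "le P a b"
proof (rule ccontr)
  assume ab: "\<not> le P a b"
  obtain x where x: "x \<in> fst ` set (lev (height b))" "b = bl (height b) x" by (rule blE[OF assms(1)])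
  obtain y where y: "y \<in> fst ` set (lev (height c))" "c = bl (height c) y" by (rule blE[OF assms(2)])
  obtain z where z: "z \<in> fst ` set (lev (height a))" "a = bl (height a) z" by (rule blE[OF assms(3)])
  obtain W where W: "level_ok (triples_ok 11) W"
    "\<And>i n. i + n \<le> 2 * length (table E8) \<Longrightarrow> take n (drop i W) = window (height b - int i) n"
    by (rule check_level[OF triples_check, of "height b"]) blast
  define n m where "n = nat (height b - height c)" and "m = nat (height b - height a)"
  have "m < 11" using full_le[OF assms(1,3)] ab unfolding m_def depth.simps by linarith
  have "n \<le> m" using assms(5) by (simp add: n_def m_def)
  have hc: "height c = height b - int n" and ha: "height a = height b - int m"
    using assms(5,6) by (simp_all add: n_def m_def)
  have G: "take 12 W = window (height b) 12" using W(2)[of 0 12] by simp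
  have N: "take 12 (drop n W) = window (height c) 12"
    using W(2)[of n 12] \<open>n \<le> m\<close> \<open>m < 11\<close> hc by simp
  have "(0 + n, y) \<in> set (gaps 0 [x] (window (height b) 12))"
    by (rule gap[of b]) (use x y assms(8) hc \<open>n \<le> m\<close> \<open>m < 11\<close> in auto)
  moreover have "(0 + m, z) \<in> set (gaps 0 [x] (window (height b) 12))"
    by (rule gap[of b]) (use x z ab ha \<open>m < 11\<close> in auto)
  \<comment> \<open>The gaps of \<open>c\<close> are counted from \<open>n\<close>, so
    \<open>z\<close> carries its depth below \<open>b\<close> in both lists.\<close>
  moreover have "(n + (m - n), z) \<in> set (gaps n [y] (window (height c) 12))"
    by (rule gap[of c]) (use y z assms(7) ha hc \<open>n \<le> m\<close> \<open>m < 11\<close> in \<open>auto simp: of_nat_diff\<close>)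
  moreover have "triples_ok 11 W x"
    by (rule level_okD[OF W(1) _ x(1)]) (use W(2)[of 0 1] in simp)
  then have "separated 11 (gaps 0 [x] (window (height b) 12)) W (gaps 0 [x] (window (height b) 12))"
    using G by simp
  moreover have "colour_of y = colour_of z" using y z assms(4) by (metis colour_bl)
  ultimately show False
    using separated_D[of 11 _ W _ n y m z] N \<open>n \<le> m\<close> by simp
qed

end

section \<open>Ideals and descents\<close>

lemma two_runs_nth:
  assumes "xs \<noteq> []"
  shows "(xs @ map f xs) ! nat (z mod (2 * int (length xs))) =
    (let x = xs ! nat (z mod int (length xs)) in if odd (z div int (length xs)) then f x else x)"
proof -
  let ?n = "int (length xs)"
  have n: "?n > 0" using assms by simp
  have z: "z mod (2 * ?n) = z mod ?n + ?n * (z div ?n mod 2)"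
    by (metis add.commute mult.commute zmod_zmult2_eq zero_le_numeral)
  have r: "0 \<le> z mod ?n" "z mod ?n < ?n" using n by simp_all
  show ?thesis
  proof (cases "odd (z div ?n)")
    case True
    then have "nat (z mod (2 * ?n)) = length xs + nat (z mod ?n)"
      using z r by (simp add: odd_iff_mod_2_eq_one nat_add_distrib)
    then show ?thesis using True r n by (simp add: nth_append nat_less_iff)
  next
    case False
    then have "nat (z mod (2 * ?n)) = nat (z mod ?n)" using z by (simp add: even_iff_mod_2_eq_zero)
    then show ?thesis using False r n by (simp add: nth_append nat_less_iff)
  qed
qed

text \<open>Cubes count from 1 and lists from 0, whence \<open>- 1\<close>. The shifts between
  columns are 8 per column in type E6 and 4 in the odd columns of type E7, where
  \<open>4 - 1 = 3\<close>.\<close>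

fun offset :: "affine_type \<Rightarrow> nat \<Rightarrow> int" where
  "offset E6 r = 8 * int r - 1"
| "offset E7 r = (if even r then - 1 else 3)"
| "offset E8 r = - 1"

lemma wall_cube_eq:
  "wall_cube T r k = sections T (odd r) ! nat ((k + offset T r) mod int (length (table T)))"
proof (cases T)
  case E6
  show ?thesis
    using two_runs_nth[of "base_cubes E6" rot_section "k + offset T r"]
    by (simp add: E6 cube_def Let_def algebra_simps)
next
  case E7
  have "map rot_section (base_cubes E7) ! nat ((k + 3) mod 8) =
      rot_section (base_cubes E7 ! nat ((k + 3) mod 8))"
    by (rule nth_map) (simp add: nat_less_iff)
  then show ?thesis by (simp add: E7 cube_def Let_def algebra_simps)
next
  case E8
  show ?thesis
    using two_runs_nth[of "base_cubes E8" rot_section "k - 1"]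
    by (simp add: E8 cube_def Let_def algebra_simps)
qed

lemma mod_pred:
  fixes a p :: int
  assumes "p > 0"
  shows "(a - 1) mod p = (if a mod p = 0 then p - 1 else a mod p - 1)"
proof -
  have "(a - 1) mod p = (a mod p - 1) mod p" by (simp add: mod_diff_left_eq)
  then show ?thesis
    using assms pos_mod_sign[OF assms, of a] pos_mod_bound[OF assms, of a]
    by (auto simp: zmod_minus1 intro!: mod_pos_pos_trivial)
qed

lemma fits_table: "fits (last (sections T \<rho>)) (sections T \<rho>) (table T)"
  by (cases T) (simp_all only: fits_E6 fits_E7 fits_E8)

lemma no_nine: "c \<in> set (sections T \<rho>) \<Longrightarrow> 9 \<notin> set (fst c) \<union> set (snd c)"
  by (cases T; cases \<rho>) auto

definition wall_level :: "affine_type \<Rightarrow> nat \<Rightarrow> int \<Rightarrow> level" where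
  "wall_level T r k = table T ! nat ((k + offset T r) mod int (length (table T)))"

definition wall_block :: "affine_type \<Rightarrow> nat \<Rightarrow> int \<Rightarrow> nat \<Rightarrow> block" where
  "wall_block T r k = block_at (wall_cube T r k) k"

lemma level_table_wall:
  "level_table T (wall_pattern T r) (offset T r) (wall_level T r) (wall_block T r)"
proof
  let ?p = "int (length (table T))" let ?c = "sections T (odd r)"
  have p: "?p > 0" by (cases T) auto
  note fit = fits_nth[OF fits_table[of T "odd r"]]
  have i: "nat ((k + offset T r) mod ?p) < length (table T)" for k using p by (simp add: nat_less_iff)
  have names: "set (names (wall_cube T r k)) = fst ` set (wall_level T r k)" for k
    unfolding wall_cube_eq wall_level_def by (rule fit(2)[OF i])
  have "wall_cube T r k \<in> set ?c" for k
    unfolding wall_cube_eq using i fit(1) by simp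
  then have "cube_blocks k (wall_cube T r k) = wall_block T r k ` fst ` set (wall_level T r k)" for k
    using cube_blocks_eq[OF no_nine] names by (metis wall_block_def)
  then show "wall_pattern T r = {wall_block T r k x |k x. x \<in> fst ` set (wall_level T r k)}"
    unfolding wall_pattern_def by auto
  fix k x S y assume a: "(x, S) \<in> set (wall_level T r k)" "y \<in> set S"
  \<comment> \<open>At remainder 0 the cube below is the last one of the cyclic list.\<close>
  have "(last ?c # ?c) ! nat ((k + offset T r) mod ?p) = wall_cube T r (k - 1)"
  proof -
    have "(k - 1 + offset T r) mod ?p =
        (if (k + offset T r) mod ?p = 0 then ?p - 1 else (k + offset T r) mod ?p - 1)"
      using mod_pred[OF p, of "k + offset T r"] by (simp add: algebra_simps)
    moreover have "last ?c = ?c ! nat (?p - 1)"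
    proof -
      have "?c \<noteq> []" "nat (?p - 1) = length ?c - 1" using fit(1) p by auto
      then show ?thesis by (simp add: last_conv_nth)
    qed
    moreover have "(k + offset T r) mod ?p > 0 \<or> (k + offset T r) mod ?p = 0"
      using pos_mod_sign[OF p, of "k + offset T r"] by linarith
    ultimately show ?thesis
      by (auto simp: wall_cube_eq nth_Cons' nat_diff_distrib)
  qed
  then have y: "y \<in> set (support (wall_cube T r k) (wall_cube T r (k - 1)) x)"
    using fit(3)[OF i, of x S k] a unfolding wall_cube_eq[of T r k] wall_level_def by auto
  then show "y \<in> fst ` set (wall_level T r (k - 1)) \<and>
       cells (wall_block T r (k - 1) y) \<inter> cells (wall_block T r k x) \<noteq> {}"
    using support_meets[OF y] names by (simp add: wall_block_def)
qed (simp_all add: wall_level_def wall_block_def block_at_def)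

section \<open>Order ideals of blocks and descent along the operators\<close>

definition ideal :: "block set \<Rightarrow> block set \<Rightarrow> bool" where
  "ideal P Y \<longleftrightarrow> Y \<subseteq> P \<and> Y \<noteq> {} \<and> (\<exists>K. \<forall>b\<in>Y. height b \<le> K) \<and> no_empty_space_below P Y"

definition filled :: "block set \<Rightarrow> int \<Rightarrow> block set" where
  "filled P K = {b \<in> P. height b \<le> K}"

lemma young_columns_eq:
  "young_columns T P = {Y. ideal P Y} \<union>
     {Y. T = E8 \<and> Y \<subseteq> P \<and> (equivalent T special1 Y \<or> equivalent T special2 Y)}"
  by (auto simp: young_columns_def ideal_def)

lemma ideal_young: "ideal P Y \<Longrightarrow> Y \<in> young_columns T P"
  by (simp add: young_columns_eq)

lemma ideal_below: "ideal P Y \<Longrightarrow> b \<in> Y \<Longrightarrow> (c, b) \<in> below P \<Longrightarrow> c \<in> Y"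
  by (auto simp: ideal_def no_empty_space_below_def below_def)

lemma ideal_le: "ideal P Y \<Longrightarrow> le P c b \<Longrightarrow> b \<in> Y \<Longrightarrow> c \<in> Y"
  by (rotate_tac 1, induction rule: converse_rtrancl_induct) (auto intro: ideal_below)

lemma idealI:
  assumes "Y \<subseteq> P" "Y \<noteq> {}" "\<And>b. b \<in> Y \<Longrightarrow> height b \<le> K"
    and "\<And>b c. b \<in> Y \<Longrightarrow> (c, b) \<in> below P \<Longrightarrow> c \<in> Y"
  shows "ideal P Y"
  using assms unfolding ideal_def no_empty_space_below_def below_def by blast

lemma le_height: "le P b c \<Longrightarrow> b = c \<or> height b < height c"
proof (induction rule: rtrancl_induct)
  case (step y z)
  then show ?case by (auto simp: below_def)
qed simp

lemma le_mem: "le P b c \<Longrightarrow> b \<noteq> c \<Longrightarrow> b \<in> P \<and> c \<in> P"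
  by (induction rule: rtrancl_induct) (auto simp: below_def)

lemma le_stepE:
  assumes "le P b c" "b \<noteq> c"
  obtains d where "(b, d) \<in> below P" "le P d c"
  using assms by (metis converse_rtranclE)

text \<open>A step may be witnessed from either end, by removing the block or by adding it back;
  both fix the change of degree. In type E8 the step from \<open>Z u\<close> to \<open>S1 u\<close>
  is witnessed by \<open>col_f\<close>.\<close>

inductive descends :: "affine_type \<Rightarrow> block set \<Rightarrow> block set \<Rightarrow> block set \<Rightarrow> bool" for T P where
  refl: "descends T P X X"
| step: "\<lbrakk>b \<in> X; colour b \<le> rank T; X \<in> young_columns T P; X - {b} \<in> young_columns T P;
    col_e T P (colour b) X = Some (X - {b}) \<or> col_f T P (colour b) (X - {b}) = Some X;
    descends T P (X - {b}) Y\<rbrakk> \<Longrightarrow> descends T P X Y"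

lemma zero_diff_remove:
  assumes "b \<in> X" "finite (X - ground_column T r)" "finite (ground_column T r - X)"
  shows "zero_diff T r (X - {b}) = zero_diff T r X - (if colour b = 0 then 1 else 0)"
proof -
  let ?G = "ground_column T r"
  have fin: "finite {c \<in> X - {b} - ?G. colour c = 0}" "finite {c \<in> ?G - X. colour c = 0}"
    by (rule finite_subset[OF _ assms(2)], blast, rule finite_subset[OF _ assms(3)], blast)
  show ?thesis
  proof (cases "colour b = 0")
    case False
    then have "{c \<in> X - {b} - ?G. colour c = 0} = {c \<in> X - ?G. colour c = 0}"
      "{c \<in> ?G - (X - {b}). colour c = 0} = {c \<in> ?G - X. colour c = 0}" by auto
    then show ?thesis using False by (simp add: zero_diff_def)
  next
    case True
    show ?thesis
    proof (cases "b \<in> ?G")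
      case b: True
      then have "{c \<in> X - {b} - ?G. colour c = 0} = {c \<in> X - ?G. colour c = 0}"
        "{c \<in> ?G - (X - {b}). colour c = 0} = insert b {c \<in> ?G - X. colour c = 0}"
        using True assms(1) by auto
      moreover have "b \<notin> {c \<in> ?G - X. colour c = 0}" using assms(1) by simp
      ultimately show ?thesis using True fin unfolding zero_diff_def by simp
    next
      case b: False
      then have "{c \<in> X - ?G. colour c = 0} = insert b {c \<in> X - {b} - ?G. colour c = 0}"
        "{c \<in> ?G - (X - {b}). colour c = 0} = {c \<in> ?G - X. colour c = 0}"
        using True assms(1) by auto
      moreover have "b \<notin> {c \<in> X - {b} - ?G. colour c = 0}" by simp
      ultimately show ?thesis using True fin unfolding zero_diff_def by simp
    qed
  qed
qed

lemma degree_descends: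
  assumes "column_identification T m r F"
    and "descends T (wall_pattern T r) X Y"
    and "finite (X - ground_column T r)" "finite (ground_column T r - X)"
  shows "fst (F X) + zero_diff T r X = fst (F Y) + zero_diff T r Y"
  using assms(2-)
proof (induction rule: descends.induct)
  case (step b X Y)
  let ?P = "wall_pattern T r" let ?i = "colour b"
  have id: "map_option F (col_f T ?P ?i Z) = aff_f T ?i (F Z)"
     "map_option F (col_e T ?P ?i Z) = aff_e T ?i (F Z)" if "Z \<in> young_columns T ?P" for Z
    using assms(1) that step.hyps(2) by (simp_all add: column_identification_def)
  have "fst (F (X - {b})) = fst (F X) + (if colour b = 0 then 1 else 0)"
    using step.hyps(5)
  proof
    assume "col_e T ?P ?i X = Some (X - {b})"
    then have "aff_e T ?i (F X) = Some (F (X - {b}))" using id(2)[OF step.hyps(3)] by simp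
    then show ?thesis by (cases "F X"; cases "F (X - {b})") auto
  next
    assume "col_f T ?P ?i (X - {b}) = Some X"
    then have "aff_f T ?i (F (X - {b})) = Some (F X)" using id(1)[OF step.hyps(4)] by simp
    then show ?thesis by (cases "F X"; cases "F (X - {b})") auto
  qed
  moreover have "zero_diff T r (X - {b}) = zero_diff T r X - (if colour b = 0 then 1 else 0)"
    using step by (intro zero_diff_remove)
  moreover have "finite (X - {b} - ground_column T r)" "finite (ground_column T r - (X - {b}))"
    using finite_subset[of "X - {b} - ground_column T r" "X - ground_column T r"]
      finite_subset[of "ground_column T r - (X - {b})" "insert b (ground_column T r - X)"] step.prems
    by auto
  ultimately show ?case using step.IH by simp
qed simp

context level_table
begin

lemma ideal_contains_filled:
  assumes "ideal P Y"
  shows "\<exists>K. filled P K \<subseteq> Y"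
proof -
  obtain b where b: "b \<in> Y" "b \<in> P" using assms by (auto simp: ideal_def)
  then have "filled P (height b - int (depth T)) \<subseteq> Y"
    using full_le[OF b(2)] ideal_le[OF assms] by (auto simp: filled_def)
  then show ?thesis by blast
qed

lemma finite_segment: "finite {b \<in> P. K < height b \<and> height b \<le> K'}"
proof -
  have "{b \<in> P. K < height b \<and> height b \<le> K'} = (\<Union>k\<in>{K<..K'}. {b \<in> P. height b = k})" by auto
  then show ?thesis using finite_level by simp
qed

lemma finite_minus_filled:
  assumes "Y \<subseteq> P" "\<And>b. b \<in> Y \<Longrightarrow> height b \<le> K'"
  shows "finite (Y - filled P K)"
  by (rule finite_subset[OF _ finite_segment[of K K']]) (use assms in \<open>auto simp: filled_def\<close>)

lemma ideal_remove_top: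
  assumes "ideal P Y" "b \<in> Y" "\<And>c. c \<in> Y \<Longrightarrow> height c \<le> height b" "filled P K \<subseteq> Y" "K < height b"
  shows "ideal P (Y - {b})"
proof (rule idealI)
  show "Y - {b} \<noteq> {}"
    using level_nonempty[of K] assms(4,5) by (force simp: filled_def)
  show "c \<in> Y - {b}" if "d \<in> Y - {b}" "(c, d) \<in> below P" for c d
    using that assms(1,3) ideal_below[OF assms(1)] by (fastforce simp: below_def)
qed (use assms in \<open>auto simp: ideal_def\<close>)

lemma ideal_top:
  assumes "ideal P Y" "filled P K \<subset> Y"
  obtains b where "b \<in> Y" "K < height b" "\<And>c. c \<in> Y \<Longrightarrow> height c \<le> height b"
proof -
  obtain K' where K': "\<And>b. b \<in> Y \<Longrightarrow> height b \<le> K'" using assms(1) by (auto simp: ideal_def)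
  have Y: "Y \<subseteq> P" using assms(1) by (auto simp: ideal_def)
  let ?A = "Y - filled P K"
  have fin: "finite ?A" using finite_minus_filled[OF Y K'] .
  have "?A \<noteq> {}" using assms(2) by blast
  then have "Max (height ` ?A) \<in> height ` ?A" using fin by simp
  then obtain b where b: "b \<in> ?A" "height b = Max (height ` ?A)" by auto
  have le: "height c \<le> height b" if "c \<in> Y" for c
  proof (cases "c \<in> filled P K")
    case True
    then show ?thesis using b(1) Y by (auto simp: filled_def)
  next
    case False
    then show ?thesis using b(2) fin that by simp
  qed
  show thesis by (rule that[of b]) (use b le Y in \<open>auto simp: filled_def\<close>)
qed

lemma descends_chain:
  assumes "T \<noteq> E8" "ideal P Y" "filled P K \<subseteq> Y"
  shows "descends T P Y (filled P K)"
  using assms(2,3)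
proof (induction "card (Y - filled P K)" arbitrary: Y rule: less_induct)
  case less
  show ?case
  proof (cases "Y = filled P K")
    case False
    then have "filled P K \<subset> Y" using less.prems by blast
    then obtain b where b: "b \<in> Y" "K < height b" "\<And>c. c \<in> Y \<Longrightarrow> height c \<le> height b"
      using ideal_top[OF less.prems(1)] by metis
    have Y: "Y \<subseteq> P" using less.prems(1) by (auto simp: ideal_def)
    let ?X = "Y - {b}"
    have X: "ideal P ?X" using ideal_remove_top[OF less.prems(1) b(1,3) less.prems(2) b(2)] .
    have sub: "filled P K \<subseteq> ?X" using less.prems(2) b(2) by (auto simp: filled_def)
    have yc: "young_columns T P = {Y. ideal P Y}" using assms(1) by (simp add: young_columns_eq)
    have "removable T P (colour b) Y = {b}"
    proof (intro equalityI subsetI)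
      fix d assume "d \<in> removable T P (colour b) Y"
      then have d: "d \<in> Y" "colour d = colour b" "ideal P (Y - {d})" by (auto simp: removable_def yc)
      then consider "le P d b" | "le P b d" using chain[OF assms(1), of d b] Y b(1) by auto
      then show "d \<in> {b}"
      proof cases
        case 1
        then show ?thesis using ideal_le[OF d(3) 1] b(1) by auto
      next
        case 2
        then show ?thesis using le_height[OF 2] b(3)[OF d(1)] by auto
      qed
    qed (use b X yc in \<open>auto simp: removable_def\<close>)
    then have "col_e T P (colour b) Y = Some ?X"
      using assms(1) by (simp add: col_e_def remove_block_def)
    moreover have "descends T P ?X (filled P K)"
    proof (rule less.hyps)
      have "finite (Y - filled P K)" using finite_minus_filled[OF Y b(3)] .
      moreover have "?X - filled P K \<subset> Y - filled P K" using b by (auto simp: filled_def)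
      ultimately show "card (?X - filled P K) < card (Y - filled P K)" by (rule psubset_card_mono)
    qed (use X sub in auto)
    moreover have "colour b \<le> rank T" using b(1) Y colour_le_rank by blast
    ultimately show ?thesis
      using descends.step[OF b(1) _ ideal_young[OF less.prems(1)] ideal_young[OF X]] by blast
  qed (simp add: descends.refl)
qed

end

section \<open>Type E8\<close>

declare names.simps [simp del] name_cells.simps [simp del]

abbreviation P8 :: "block set" where
  "P8 \<equiv> column_pattern E8"

abbreviation lev8 :: "int \<Rightarrow> level" where
  "lev8 \<equiv> wall_level E8 0"

abbreviation bl8 :: "int \<Rightarrow> nat \<Rightarrow> block" where
  "bl8 \<equiv> wall_block E8 0"

lemma wall_pattern_E8: "wall_pattern E8 r = P8"
  by (simp add: wall_pattern_def column_pattern_def)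

interpretation E8: E8_table P8 lev8 bl8
  using level_table_wall[of E8 0] by (simp add: wall_pattern_E8 E8_table_def)

section \<open>Automorphisms of the E8 pattern\<close>

lemma rot_section_involutive [simp]: "rot_section (rot_section x) = x"
  by (cases x) simp

lemma cube_add_10: "cube E8 (k + 10) = rot_section (cube E8 k)"
proof -
  have "k + 10 - 1 = (k - 1) + 10" by simp
  then have "(k + 10 - 1) mod 10 = (k - 1) mod 10" "(k + 10 - 1) div 10 = (k - 1) div 10 + 1"
    by (simp_all only: mod_add_self2 div_add_self2[OF zero_neq_numeral[symmetric]])
  moreover have "length (base_cubes E8) = 10" by simp
  ultimately show ?thesis unfolding cube_def Let_def by (simp del: base_cubes.simps)
qed

lemma cube_add_20: "cube E8 (k + 20 * w) = cube E8 k"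
proof -
  have "k + 20 * w - 1 = (k - 1) + 10 * (2 * w)" by simp
  then have "(k + 20 * w - 1) mod 10 = (k - 1) mod 10" "(k + 20 * w - 1) div 10 = 2 * w + (k - 1) div 10"
    by (simp_all only: mod_mult_self2 div_mult_self2[OF zero_neq_numeral[symmetric]])
  moreover have "length (base_cubes E8) = 10" by simp
  ultimately show ?thesis unfolding cube_def Let_def by (simp del: base_cubes.simps)
qed

text \<open>Only the colour is matched, not the name: rotation exchanges the two 4-blocks of a cube
  \<open>444444\<close>. The bound 6 makes \<open>7 - j\<close> an involution on the natural numbers
  that occur.\<close>

fun rotates :: "cross_section \<Rightarrow> nat list \<Rightarrow> bool" where
  "rotates c [] = True"
| "rotates c (x # xs) =
    (list_ex (\<lambda>y. colour_of y = colour_of x \<and>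
        set (name_cells (rot_section c) y) = rot_cell E8 ` set (name_cells c x)) (names (rot_section c))
     \<and> list_all (\<lambda>(a, j). j \<le> 6) (name_cells c x) \<and> rotates c xs)"

fun all_rotate :: "cross_section list \<Rightarrow> bool" where
  "all_rotate [] = True"
| "all_rotate (c # cs) = (rotates c (names c) \<and> all_rotate cs)"

lemma rotate_check: "all_rotate (sections E8 False)"
  by code_simp

lemma cube_in_sections: "cube E8 k \<in> set (sections E8 False)"
proof -
  have "nat ((k - 1) mod 20) < length (sections E8 False)" by (simp add: nat_less_iff)
  moreover have "length (table E8) = 20" by simp
  then have "cube E8 k = sections E8 False ! nat ((k - 1) mod 20)"
    using wall_cube_eq[of E8 0 k] by (simp del: table.simps sections.simps)
  ultimately show ?thesis by (metis nth_mem)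
qed

lemma P8_eq: "P8 = {block_at (cube E8 k) k x | k x. x \<in> set (names (cube E8 k))}"
proof -
  have "cube_blocks k (cube E8 k) = block_at (cube E8 k) k ` set (names (cube E8 k))" for k
    by (rule cube_blocks_eq[OF no_nine[OF cube_in_sections]])
  then show ?thesis unfolding column_pattern_def by auto
qed

lemma all_rotateD: "all_rotate cs \<Longrightarrow> c \<in> set cs \<Longrightarrow> rotates c (names c)"
  by (induction cs) auto

lemma rotatesD:
  "rotates c xs \<Longrightarrow> x \<in> set xs \<Longrightarrow>
    (\<exists>y \<in> set (names (rot_section c)). colour_of y = colour_of x \<and>
        set (name_cells (rot_section c) y) = rot_cell E8 ` set (name_cells c x))
     \<and> (\<forall>(a, j) \<in> set (name_cells c x). j \<le> 6)"
  by (induction c xs rule: rotates.induct) (auto simp: list_ex_iff list_all_iff)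

lemma move_10_mem:
  assumes "b \<in> P8"
  shows "move E8 10 True b \<in> P8" "(a, j) \<in> cells b \<Longrightarrow> j \<le> 6"
proof -
  obtain k x where b: "b = block_at (cube E8 k) k x" "x \<in> set (names (cube E8 k))"
    using assms by (auto simp: P8_eq)
  note r = rotatesD[OF all_rotateD[OF rotate_check cube_in_sections] b(2)]
  then obtain y where "y \<in> set (names (cube E8 (k + 10)))" "colour_of y = colour_of x"
    "set (name_cells (cube E8 (k + 10)) y) = rot_cell E8 ` set (name_cells (cube E8 k) x)"
    unfolding cube_add_10 by blast
  then show "move E8 10 True b \<in> P8"
    unfolding P8_eq b(1) block_at_def by (intro CollectI exI[of _ "k + 10"] exI[of _ y]) simp
  show "(a, j) \<in> cells b \<Longrightarrow> j \<le> 6" using r b(1) by (auto simp: block_at_def)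
qed

lemma move_20_mem:
  assumes "b \<in> P8"
  shows "move E8 (20 * w) False b \<in> P8"
proof -
  obtain k x where b: "b = block_at (cube E8 k) k x" "x \<in> set (names (cube E8 k))"
    using assms by (auto simp: P8_eq)
  then have "move E8 (20 * w) False b = block_at (cube E8 (k + 20 * w)) (k + 20 * w) x"
    by (simp add: block_at_def cube_add_20)
  then show ?thesis using b(2) unfolding P8_eq
    by (intro CollectI exI[of _ "k + 20 * w"] exI[of _ x]) (simp add: cube_add_20)
qed

text \<open>For \<open>10 dvd u\<close> this is an automorphism of the pattern.\<close>

definition turn :: "int \<Rightarrow> block \<Rightarrow> block" where
  "turn u = move E8 u (odd (u div 10))"

lemma height_move [simp]: "height (move T t \<rho> b) = height b + t"
  and colour_move [simp]: "colour (move T t \<rho> b) = colour b"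
  and cells_move: "cells (move T t \<rho> b) = (if \<rho> then rot_cell T ` cells b else cells b)"
  by (cases b; simp)+

lemma height_turn [simp]: "height (turn u b) = height b + u"
  and colour_turn [simp]: "colour (turn u b) = colour b"
  by (simp_all add: turn_def)

lemma block_eqI: "height b = height c \<Longrightarrow> cells b = cells c \<Longrightarrow> colour b = colour c \<Longrightarrow> b = c"
  by (cases b; cases c) simp

lemma turn_mem:
  assumes "10 dvd u" "b \<in> P8"
  shows "turn u b \<in> P8"
proof (cases "odd (u div 10)")
  case True
  then obtain w where "u div 10 = 2 * w + 1" by (rule oddE)
  then have w: "u = 10 + 20 * w" using assms(1) by auto
  have "turn u b = move E8 10 True (move E8 (20 * w) False b)"
    by (rule block_eqI) (use True w in \<open>simp_all add: turn_def cells_move\<close>)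
  then show ?thesis using move_10_mem(1)[OF move_20_mem[OF assms(2)]] by simp
next
  case False
  then obtain w where "u div 10 = 2 * w" by blast
  then have "u = 20 * w" using assms(1) by auto
  then show ?thesis using move_20_mem[OF assms(2), of w] False by (simp add: turn_def)
qed

lemma turn_turn:
  assumes "10 dvd u" "b \<in> P8"
  shows "turn u (turn (- u) b) = b"
proof -
  have "odd (- u div 10) = odd (u div 10)" using assms(1) by (simp add: dvd_neg_div)
  moreover have "rot_cell E8 ` rot_cell E8 ` cells b = cells b"
  proof -
    have "rot_cell E8 (rot_cell E8 (a, j)) = (a, j)" if "(a, j) \<in> cells b" for a j
      using move_10_mem(2)[OF assms(2) that] by (cases a) auto
    then show ?thesis by (force simp: image_image)
  qed
  ultimately show ?thesis by (intro block_eqI) (simp_all add: turn_def cells_move)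
qed

lemma turn_surj:
  assumes "10 dvd u" "b \<in> P8"
  obtains c where "c \<in> P8" "b = turn u c"
  by (rule that[of "turn (- u) b"]) (use assms turn_turn turn_mem[of "- u"] in auto)

lemma turn_inj:
  assumes "10 dvd u" "b \<in> P8" "c \<in> P8" "turn u b = turn u c"
  shows "b = c"
  using turn_turn[of "- u" b] turn_turn[of "- u" c] assms by simp

lemma turn_below:
  assumes "10 dvd u" "(b, c) \<in> below P8"
  shows "(turn u b, turn u c) \<in> below P8"
  using assms turn_mem by (auto simp: below_def turn_def cells_move)

lemma turn_filled:
  assumes "10 dvd u"
  shows "turn u ` filled P8 K = filled P8 (K + u)"
proof (intro equalityI subsetI)
  fix b assume "b \<in> filled P8 (K + u)"
  then have b: "b \<in> P8" "height b \<le> K + u" by (simp_all add: filled_def)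
  obtain c where "c \<in> P8" "b = turn u c" by (rule turn_surj[OF assms b(1)])
  then show "b \<in> turn u ` filled P8 K" using b(2) by (auto simp: filled_def)
qed (use assms turn_mem in \<open>auto simp: filled_def\<close>)

fun present :: "cross_section \<Rightarrow> bool \<Rightarrow> cell list \<Rightarrow> nat \<Rightarrow> bool" where
  "present c \<rho> S i = list_ex (\<lambda>x. colour_of x = i \<and>
     set (name_cells c x) = (if \<rho> then rot_cell E8 ` set S else set S)) (names c)"

text \<open>These three blocks belong to both special columns, and the demand that they land in the
  pattern already pins down the motion.\<close>

fun special_fits :: "int \<Rightarrow> bool \<Rightarrow> bool" where
  "special_fits t \<rho> \<longleftrightarrow>
     present (cube E8 (6 + t)) \<rho> (name_cells (cube E8 6) 9) 4 \<and>
     present (cube E8 (5 + t)) \<rho> (name_cells (cube E8 5) 3) 3 \<and>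
     present (cube E8 (5 + t)) \<rho> (name_cells (cube E8 5) 5) 5"

fun special_check :: "nat \<Rightarrow> bool" where
  "special_check 0 = True"
| "special_check (Suc n) =
    ((special_fits (int n) True \<longrightarrow> n = 10) \<and> (special_fits (int n) False \<longrightarrow> n = 0) \<and> special_check n)"

lemma special_check_20: "special_check 20"
  by code_simp

lemma special_checkD:
  "special_check m \<Longrightarrow> n < m \<Longrightarrow> special_fits (int n) \<rho> \<Longrightarrow> n = (if \<rho> then 10 else 0)"
  by (induction m) (auto simp: less_Suc_eq simp del: special_fits.simps split: if_splits)


lemma present_if_mem:
  assumes "move E8 t \<rho> (bl8 k x) \<in> P8"
  shows "present (cube E8 (k + t mod 20)) \<rho> (name_cells (cube E8 k) x) (colour_of x)"
proof -
  obtain j y where y: "y \<in> set (names (cube E8 j))"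
    "move E8 t \<rho> (bl8 k x) = block_at (cube E8 j) j y" using assms unfolding P8_eq by blast
  have j: "j = k + t" using arg_cong[OF y(2), of height]
    by (simp add: block_at_def wall_block_def)
  have "cube E8 (k + t) = cube E8 (k + t mod 20 + 20 * (t div 20))"
    by (simp add: algebra_simps)
  then have "cube E8 (k + t) = cube E8 (k + t mod 20)" unfolding cube_add_20 .
  then show ?thesis
    using y j by (auto simp: list_ex_iff block_at_def wall_block_def intro!: bexI[of _ y] split: if_splits)
qed

text \<open>Equivalence admits every translation and rotation, but whether the three blocks land in
  the pattern depends only on \<open>\<rho>\<close> and \<open>t\<close> modulo 20. The 20 residues
  leave 0 without rotation and 10 with it.\<close>

lemma turn_if_special:
  assumes "move E8 t \<rho> (bl8 6 9) \<in> P8" "move E8 t \<rho> (bl8 5 3) \<in> P8" "move E8 t \<rho> (bl8 5 5) \<in> P8"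
  shows "10 dvd t \<and> move E8 t \<rho> = turn t"
proof -
  have "special_fits (int (nat (t mod 20))) \<rho>"
    using present_if_mem[OF assms(1)] present_if_mem[OF assms(2)] present_if_mem[OF assms(3)]
    by (simp add: colour_of_def del: present.simps)
  then have "nat (t mod 20) = (if \<rho> then 10 else 0)"
    by (rule special_checkD[OF special_check_20, rotated]) (simp add: nat_less_iff)
  then have t: "t mod 20 = (if \<rho> then 10 else 0)" by (auto split: if_splits)
  then have "10 dvd t" "\<rho> = odd (t div 10)" by (cases \<rho>; simp; presburger)+
  then show ?thesis by (simp add: turn_def)
qed

text \<open>The special columns \<open>S1\<close>, \<open>S2\<close> and the blocks in which they differ from ideals: \<open>half\<close> and
  \<open>other\<close> are the two \<open>4\<close>-blocks of a cube \<open>444444\<close>, \<open>two\<close> lies below \<open>half\<close>, and \<open>upper\<close> rests on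
  both.\<close>

definition two :: "int \<Rightarrow> block" where
  "two u = turn u (bl8 5 2)"

definition half :: "int \<Rightarrow> block" where
  "half u = turn u (bl8 6 9)"

definition other :: "int \<Rightarrow> block" where
  "other u = turn u (bl8 6 4)"

definition upper :: "int \<Rightarrow> block" where
  "upper u = turn u (bl8 7 2)"

definition S1 :: "int \<Rightarrow> block set" where
  "S1 u = insert (half u) (filled P8 (5 + u) - {two u})"

definition S2 :: "int \<Rightarrow> block set" where
  "S2 u = {half u, upper u} \<union> filled P8 (5 + u)"

lemma lev8_eqs:
  "lev8 4 = [(6,[7,5]), (4,[5,3]), (1,[3])]"
  "lev8 5 = [(5,[6,4]), (2,[4]), (3,[4,1])]"
  "lev8 6 = [(4,[5,2]), (9,[2,3])]"
  "lev8 7 = [(3,[4]), (2,[4,9]), (5,[9])]"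
  "lev8 8 = [(1,[3]), (4,[3,2,5]), (6,[5])]"
  by (simp_all add: wall_level_def eval_nat_numeral)

lemma lev8_blockE: "b \<in> P8 \<Longrightarrow> height b = k \<Longrightarrow> \<exists>x \<in> fst ` set (lev8 k). b = bl8 k x"
  by (metis E8.blE)

lemma lev8_blocks:
  "b \<in> P8 \<Longrightarrow> height b = 4 \<Longrightarrow> b \<in> {bl8 4 6, bl8 4 4, bl8 4 1}"
  "b \<in> P8 \<Longrightarrow> height b = 5 \<Longrightarrow> b \<in> {bl8 5 5, bl8 5 2, bl8 5 3}"
  "b \<in> P8 \<Longrightarrow> height b = 6 \<Longrightarrow> b \<in> {bl8 6 4, bl8 6 9}"
  "b \<in> P8 \<Longrightarrow> height b = 7 \<Longrightarrow> b \<in> {bl8 7 3, bl8 7 2, bl8 7 5}"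
  "b \<in> P8 \<Longrightarrow> height b = 8 \<Longrightarrow> b \<in> {bl8 8 1, bl8 8 4, bl8 8 6}"
  by (drule (1) lev8_blockE, force simp: lev8_eqs)+

lemma bl8_mem:
  "bl8 5 5 \<in> P8" "bl8 5 2 \<in> P8" "bl8 5 3 \<in> P8" "bl8 6 4 \<in> P8" "bl8 6 9 \<in> P8" "bl8 7 2 \<in> P8"
  by (rule E8.blI; simp add: lev8_eqs)+

lemma bl8_below:
  "(bl8 5 2, bl8 6 9) \<in> below P8" "(bl8 6 4, bl8 7 2) \<in> below P8"
  "(bl8 4 4, bl8 5 5) \<in> below P8" "(bl8 7 3, bl8 8 4) \<in> below P8"
  "(bl8 5 5, bl8 6 4) \<in> below P8" "(bl8 5 3, bl8 6 9) \<in> below P8"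
  using E8.below_bl[of _ _ 6] E8.below_bl[of _ _ 7] E8.below_bl[of _ _ 5] E8.below_bl[of _ _ 8]
  by (simp_all add: lev8_eqs)

lemma half_0: "bl8 6 9 = Block 6 (UNIV \<times> {4..6}) 4"
proof -
  have "(UNIV :: row set) = {Upper, Lower}" using row.exhaust by blast
  moreover have "{4..6::nat} = {4, 5, 6}" by auto
  ultimately show ?thesis
    by (auto simp: wall_block_def block_at_def colour_of_def cube_def name_cells.simps eval_nat_numeral)
qed

lemma inj_turn: "10 dvd u \<Longrightarrow> inj_on (turn u) P8"
  using turn_inj by (auto intro: inj_onI)

lemma half_neq_other: "10 dvd u \<Longrightarrow> half u \<noteq> other u"
proof
  assume "10 dvd u" "half u = other u"
  then have "bl8 6 9 = bl8 6 4" using turn_inj bl8_mem unfolding half_def other_def by blast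
  then have "cells (bl8 6 9) = cells (bl8 6 4)" by simp
  moreover have "(Upper, 4) \<in> cells (bl8 6 9)" "(Upper, 4) \<notin> cells (bl8 6 4)"
    by (simp_all add: wall_block_def block_at_def cube_def name_cells.simps eval_nat_numeral)
  ultimately show False by simp
qed

lemma special1_eq: "special1 = insert (bl8 6 9) (filled P8 5 - {bl8 5 2})"
proof -
  have "{b \<in> P8. height b = 5 \<and> colour b \<in> {5, 3}} = {b \<in> P8. height b = 5} - {bl8 5 2}"
  proof -
    have "colour b \<in> {5, 3} \<longleftrightarrow> b \<noteq> bl8 5 2" if "b \<in> P8" "height b = 5" for b
      using lev8_blocks(2)[OF that]
      by (auto simp: colour_of_def dest: arg_cong[of _ _ colour])
    then show ?thesis by blast
  qed
  moreover have "filled P8 5 = {b \<in> P8. height b \<le> 4} \<union> {b \<in> P8. height b = 5}"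
    by (auto simp: filled_def)
  moreover have "bl8 5 2 \<notin> {b \<in> P8. height b \<le> 4}" by simp
  ultimately show ?thesis unfolding special1_def half_0 by blast
qed

lemma special2_eq: "special2 = {bl8 6 9, bl8 7 2} \<union> filled P8 5"
proof -
  have *: "{b \<in> P8. height b = 7 \<and> colour b = 2} = {bl8 7 2}"
  proof -
    have "b = bl8 7 2" if "b \<in> P8" "height b = 7" "colour b = 2" for b
      using lev8_blocks(4)[OF that(1,2)] that(3) by (auto simp: colour_of_def)
    moreover have "height (bl8 7 2) = 7" "colour (bl8 7 2) = 2" by (simp_all add: colour_of_def)
    ultimately show ?thesis using bl8_mem by blast
  qed
  show ?thesis unfolding special2_def half_0 filled_def * by blast
qed

lemma special_eqs:
  assumes "10 dvd u"
  shows "turn u ` special1 = S1 u" "turn u ` special2 = S2 u"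
proof -
  have "turn u ` (filled P8 5 - {bl8 5 2}) = turn u ` filled P8 5 - turn u ` {bl8 5 2}"
    by (rule inj_on_image_set_diff[OF inj_turn[OF assms]]) (use bl8_mem in \<open>auto simp: filled_def\<close>)
  then show "turn u ` special1 = S1 u"
    by (simp add: special1_eq S1_def half_def two_def turn_filled[OF assms])
  show "turn u ` special2 = S2 u"
    by (simp add: special2_eq S2_def half_def upper_def turn_filled[OF assms])
qed

lemma S_subset:
  assumes "10 dvd u"
  shows "half u \<in> P8" "two u \<in> P8" "upper u \<in> P8" "other u \<in> P8" "S1 u \<subseteq> P8" "S2 u \<subseteq> P8"
proof -
  show *: "half u \<in> P8" "two u \<in> P8" "upper u \<in> P8" "other u \<in> P8"
    using turn_mem[OF assms] bl8_mem by (simp_all add: half_def two_def upper_def other_def)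
  show "S1 u \<subseteq> P8" "S2 u \<subseteq> P8" using * by (auto simp: S1_def S2_def filled_def)
qed

lemma young_columns_E8:
  "young_columns E8 P8 = {Y. ideal P8 Y} \<union> S1 ` {u. 10 dvd u} \<union> S2 ` {u. 10 dvd u}"
proof -
  have 1: "\<exists>u. 10 dvd u \<and> Y = turn u ` S"
    if S: "{bl8 6 9, bl8 5 3, bl8 5 5} \<subseteq> S" and Y: "Y \<subseteq> P8" "equivalent E8 S Y" for S Y
  proof -
    obtain t \<rho> where t: "Y = move E8 t \<rho> ` S" using Y(2) by (auto simp: equivalent_def)
    then have "10 dvd t \<and> move E8 t \<rho> = turn t"
      using S Y(1) by (intro turn_if_special) auto
    then show ?thesis using t by auto
  qed
  have "{bl8 6 9, bl8 5 3, bl8 5 5} \<subseteq> special1" "{bl8 6 9, bl8 5 3, bl8 5 5} \<subseteq> special2"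
    unfolding special1_eq special2_eq using bl8_mem
    by (auto simp: filled_def dest!: arg_cong[of _ _ colour] simp: colour_of_def)
  note 2 = 1[OF this(1)] 1[OF this(2)]
  have 3: "equivalent E8 S (turn u ` S)" for S u by (auto simp: equivalent_def turn_def)
  have "(Y \<subseteq> P8 \<and> equivalent E8 special1 Y) \<longleftrightarrow> Y \<in> S1 ` {u. 10 dvd u}" for Y
  proof
    assume "Y \<subseteq> P8 \<and> equivalent E8 special1 Y"
    then show "Y \<in> S1 ` {u. 10 dvd u}" using 2(1)[of Y] by (auto simp: special_eqs)
  next
    assume "Y \<in> S1 ` {u. 10 dvd u}"
    then show "Y \<subseteq> P8 \<and> equivalent E8 special1 Y" using 3[of special1] S_subset(5)
      by (auto simp flip: special_eqs(1))
  qed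
  moreover have "(Y \<subseteq> P8 \<and> equivalent E8 special2 Y) \<longleftrightarrow> Y \<in> S2 ` {u. 10 dvd u}" for Y
  proof
    assume "Y \<subseteq> P8 \<and> equivalent E8 special2 Y"
    then show "Y \<in> S2 ` {u. 10 dvd u}" using 2(2)[of Y] by (auto simp: special_eqs)
  next
    assume "Y \<in> S2 ` {u. 10 dvd u}"
    then show "Y \<subseteq> P8 \<and> equivalent E8 special2 Y" using 3[of special2] S_subset(6)
      by (auto simp flip: special_eqs(2))
  qed
  ultimately have "{Y. Y \<subseteq> P8 \<and> equivalent E8 special1 Y} = S1 ` {u. 10 dvd u}"
    "{Y. Y \<subseteq> P8 \<and> equivalent E8 special2 Y} = S2 ` {u. 10 dvd u}"
    by (simp_all only: Collect_mem_eq)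
  moreover have "{Y. E8 = E8 \<and> Y \<subseteq> P8 \<and> (equivalent E8 special1 Y \<or> equivalent E8 special2 Y)} =
      {Y. Y \<subseteq> P8 \<and> equivalent E8 special1 Y} \<union> {Y. Y \<subseteq> P8 \<and> equivalent E8 special2 Y}" by auto
  ultimately show ?thesis unfolding young_columns_eq by (simp only: Un_assoc)
qed

lemma height_special [simp]:
  "height (two u) = 5 + u" "height (half u) = 6 + u" "height (other u) = 6 + u" "height (upper u) = 7 + u"
  and colour_special [simp]:
  "colour (two u) = 2" "colour (half u) = 4" "colour (other u) = 4" "colour (upper u) = 2"
  by (simp_all add: two_def half_def other_def upper_def colour_of_def)

lemma below_special:
  assumes "10 dvd u"
  shows "(two u, half u) \<in> below P8" "(other u, upper u) \<in> below P8"
  using turn_below[OF assms] bl8_below by (simp_all add: two_def half_def other_def upper_def)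

lemma level_6:
  assumes "10 dvd u" "b \<in> P8" "height b = 6 + u"
  shows "b = half u \<or> b = other u"
proof -
  obtain c where "c \<in> P8" "b = turn u c" by (rule turn_surj[OF assms(1,2)])
  then show ?thesis using lev8_blocks(3)[of c] assms(3) by (auto simp: half_def other_def)
qed

text \<open>Shows that no 4-block can be taken from \<open>filled P8 (5 + u) - {two u}\<close> so as
  to leave an ideal. At height \<open>4 + u\<close> the 5-block above it serves; from lower down, a
  covering block stays below the level of \<open>two u\<close>.\<close>

lemma four_level_4:
  assumes "10 dvd u" "b \<in> P8" "height b \<le> 5 + u" "colour b = 4"
  shows "\<exists>c \<in> P8. (b, c) \<in> below P8 \<and> height c \<le> 5 + u \<and> c \<noteq> two u"
proof (cases "height b = 4 + u")
  case True
  obtain c where c: "c \<in> P8" "b = turn u c" by (rule turn_surj[OF assms(1,2)])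
  then have "c = bl8 4 4" using lev8_blocks(1)[of c] True assms(4) by (auto simp: colour_of_def)
  then have "(b, turn u (bl8 5 5)) \<in> below P8" using turn_below[OF assms(1) bl8_below(3)] c(2) by simp
  moreover have "turn u (bl8 5 5) \<noteq> two u" by (auto dest!: arg_cong[of _ _ colour] simp: colour_of_def)
  ultimately show ?thesis by (intro bexI[of _ "turn u (bl8 5 5)"]) (auto simp: below_def)
next
  case False
  moreover have "height b \<noteq> 5 + u"
  proof
    assume h: "height b = 5 + u"
    obtain c where "c \<in> P8" "b = turn u c" by (rule turn_surj[OF assms(1,2)])
    then show False using lev8_blocks(2)[of c] h assms(4) by (auto simp: colour_of_def)
  qed
  ultimately have "height b < 4 + u" using assms(3) by simp
  then show ?thesis using E8.cover[OF assms(2)] by fastforce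
qed

text \<open>The counterpart for adding: at these heights the only 4-block rests on a 3-block, which
  is absent if \<open>upper u\<close> is the only block present at height
  \<open>7 + u\<close>.\<close>

lemma four_level_8:
  assumes "10 dvd u" "b \<in> P8" "6 + u < height b" "height b \<le> 8 + u" "colour b = 4"
  shows "\<exists>c. (c, b) \<in> below P8 \<and> height c = 7 + u \<and> c \<noteq> upper u"
proof -
  obtain c where c: "c \<in> P8" "b = turn u c" by (rule turn_surj[OF assms(1,2)])
  then have "height c = 7 \<or> height c = 8" using assms(3,4) by auto
  then have "c = bl8 8 4" using lev8_blocks(4,5)[of c] c assms(5) by (auto simp: colour_of_def)
  then have "(turn u (bl8 7 3), b) \<in> below P8" using turn_below[OF assms(1) bl8_below(4)] c(2) by simp
  moreover have "turn u (bl8 7 3) \<noteq> upper u"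
    by (auto dest!: arg_cong[of _ _ colour] simp: colour_of_def)
  ultimately show ?thesis by (intro exI[of _ "turn u (bl8 7 3)"]) simp
qed

lemma on_top_special:
  assumes "10 dvd u"
  shows "on_top_of P8 5 (other u)" "on_top_of P8 3 (half u)"
proof -
  show "on_top_of P8 5 (other u)" using turn_below[OF assms bl8_below(5)]
    by (auto simp: on_top_of_def below_def other_def colour_of_def intro!: bexI[of _ "turn u (bl8 5 5)"])
  show "on_top_of P8 3 (half u)" using turn_below[OF assms bl8_below(6)]
    by (auto simp: on_top_of_def below_def half_def colour_of_def intro!: bexI[of _ "turn u (bl8 5 3)"])
qed

text \<open>The two classes of colours are the bipartition of the Dynkin diagram. A block thus never
  lies directly below one of its own colour.\<close>

lemma colour_parity:
  assumes "b \<in> P8"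
  shows "colour b \<in> {1, 4, 6, 8} \<longleftrightarrow> even (height b)"
proof -
  obtain x where x: "x \<in> fst ` set (lev8 (height b))" "b = bl8 (height b) x" by (rule E8.blE[OF assms])
  define i where "i = nat ((height b - 1) mod 20)"
  have i: "i < 20" "even i = odd (height b)"
  proof -
    show "i < 20" by (simp add: i_def nat_less_iff)
    have "int i = (height b - 1) mod 20" by (simp add: i_def)
    then show "even i = odd (height b)" by presburger
  qed
  have "\<forall>i \<in> set [0..<20]. \<forall>e \<in> set (table E8 ! i). colour_of (fst e) \<in> set [1, 4, 6, 8] \<longleftrightarrow> odd i"
    by code_simp
  moreover have "x \<in> fst ` set (table E8 ! i)" using x(1) by (simp add: wall_level_def i_def del: table.simps) (simp)
  moreover have "colour b = colour_of x" using x(2) by (metis E8.colour_bl)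
  ultimately show ?thesis using i by fastforce
qed

text \<open>The only ideal which the operator for the colour of its highest block annihilates: it is the
  middle of the \<open>2\<close>-string through \<open>S1 u\<close> and \<open>S2 u\<close>.\<close>

definition Z :: "int \<Rightarrow> block set" where
  "Z u = insert (half u) (filled P8 (5 + u))"

section \<open>Young columns of type E8 and their incomparable blocks\<close>

lemma young_E8_cases:
  assumes "Y \<in> young_columns E8 P8"
  obtains "ideal P8 Y" | u where "10 dvd u" "Y = S1 u" | u where "10 dvd u" "Y = S2 u"
  using assms by (auto simp: young_columns_E8)

lemma S1_young: "10 dvd u \<Longrightarrow> S1 u \<in> young_columns E8 P8"
  and S2_young: "10 dvd u \<Longrightarrow> S2 u \<in> young_columns E8 P8"
  by (auto simp: young_columns_E8)

lemma young_subset: "Y \<in> young_columns E8 P8 \<Longrightarrow> Y \<subseteq> P8"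
  by (auto simp: young_columns_def)

lemma ideal_special:
  assumes "10 dvd u" "ideal P8 Y"
  shows "half u \<in> Y \<Longrightarrow> two u \<in> Y" "upper u \<in> Y \<Longrightarrow> other u \<in> Y"
  using ideal_below[OF assms(2)] below_special[OF assms(1)] by blast+

lemma special_mem:
  assumes "10 dvd u"
  shows "two u \<in> filled P8 (5 + u)" "half u \<notin> filled P8 (5 + u)" "upper u \<notin> filled P8 (5 + u)"
    "other u \<notin> filled P8 (5 + u)" "two u \<notin> S1 u" "upper u \<notin> S1 u" "other u \<notin> S1 u" "other u \<notin> S2 u"
    "half u \<noteq> two u" "half u \<noteq> upper u" "other u \<noteq> upper u" "two u \<noteq> upper u" "other u \<noteq> two u"
proof -
  show 1: "half u \<noteq> two u" "half u \<noteq> upper u" "other u \<noteq> upper u" "two u \<noteq> upper u" "other u \<noteq> two u"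
    by (auto dest!: arg_cong[of _ _ height])
  show "two u \<in> filled P8 (5 + u)" "half u \<notin> filled P8 (5 + u)" "upper u \<notin> filled P8 (5 + u)"
    "other u \<notin> filled P8 (5 + u)"
    using S_subset[OF assms] by (auto simp: filled_def)
  then show "two u \<notin> S1 u" "upper u \<notin> S1 u" "other u \<notin> S1 u" "other u \<notin> S2 u"
    using 1 half_neq_other[OF assms] by (auto simp: S1_def S2_def)
qed

lemma height_S: "b \<in> S1 u \<Longrightarrow> height b \<le> 6 + u" "b \<in> S2 u \<Longrightarrow> height b \<le> 7 + u"
  by (auto simp: S1_def S2_def filled_def)

lemma ideal_lower: "ideal P8 (filled P8 (5 + u) - {two u})"
proof (rule idealI)
  show "filled P8 (5 + u) - {two u} \<noteq> {}"
    using E8.level_nonempty[of "4 + u"] by (force simp: filled_def)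
  show "c \<in> filled P8 (5 + u) - {two u}"
    if "b \<in> filled P8 (5 + u) - {two u}" "(c, b) \<in> below P8" for b c
    using that by (auto simp: filled_def below_def)
qed (auto simp: filled_def)

lemma ideal_Z:
  assumes "10 dvd u"
  shows "ideal P8 (Z u)"
proof (rule idealI)
  show "b \<in> Z u \<Longrightarrow> height b \<le> 6 + u" for b by (auto simp: Z_def filled_def)
  show "Z u \<subseteq> P8" using S_subset[OF assms] by (auto simp: Z_def filled_def)
  show "c \<in> Z u" if "b \<in> Z u" "(c, b) \<in> below P8" for b c
    using that by (auto simp: Z_def filled_def below_def)
qed (simp add: Z_def)

text \<open>Special columns are closed downwards within each colour: in \<open>S1 u\<close> the
  missing \<open>two u\<close> has only \<open>half u\<close> higher than it, in \<open>S2 u\<close>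
  the missing \<open>other u\<close> has only \<open>upper u\<close>, and the colours
  differ.\<close>

lemma young_same_colour:
  assumes "Y \<in> young_columns E8 P8" "b \<in> Y" "le P8 c b" "colour c = colour b"
  shows "c \<in> Y"
proof (cases "c = b")
  case False
  then have c: "c \<in> P8" "height c < height b" using le_mem[OF assms(3)] le_height[OF assms(3)] by auto
  from assms(1) show ?thesis
  proof (cases rule: young_E8_cases)
    case 1
    then show ?thesis using ideal_le assms by blast
  next
    case (2 u)
    then show ?thesis using assms(2,4) c by (auto simp: S1_def filled_def)
  next
    case (3 u)
    have "colour c = 4" if "height c = 6 + u" using level_6[OF 3(1) c(1) that] by auto
    then show ?thesis using 3 assms(2,4) c by (force simp: S2_def filled_def)
  qed
qed (use assms in simp)

lemma addable_le:
  assumes "x \<in> addable E8 P8 j X" "y \<in> addable E8 P8 j X" "x \<noteq> y"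
  shows "\<not> le P8 x y"
  using young_same_colour[of "insert y X" y x] assms by (auto simp: addable_def)

lemma removable_le:
  assumes "x \<in> removable E8 P8 j X" "y \<in> removable E8 P8 j X" "x \<noteq> y"
  shows "\<not> le P8 x y"
  using young_same_colour[of "X - {x}" y x] assms by (auto simp: removable_def)

lemma incomparable:
  assumes "a \<in> P8" "c \<in> P8" "colour a = colour c" "\<not> le P8 a c" "\<not> le P8 c a"
  shows "colour a \<noteq> 2" "\<bar>height a - height c\<bar> \<le> 10" "colour a = 4 \<longleftrightarrow> height a = height c"
    "\<exists>u. 10 dvd u \<and> height a + height c = 12 + 2 * u"
proof -
  have "colour a \<noteq> 2 \<and> \<bar>height a - height c\<bar> \<le> 10 \<and> (colour a = 4 \<longleftrightarrow> height a = height c) \<and>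
    (\<exists>u. 10 dvd u \<and> height a + height c = 12 + 2 * u)"
  proof (cases "height c \<le> height a")
    case True
    then show ?thesis using E8.pairs[OF assms(1,2,3) True assms(5)] by auto
  next
    case False
    then have le: "height a \<le> height c" by simp
    show ?thesis using E8.pairs[OF assms(2,1) assms(3)[symmetric] le assms(4)] le assms(3)
      by (auto simp: add.commute)
  qed
  then show "colour a \<noteq> 2" "\<bar>height a - height c\<bar> \<le> 10" "colour a = 4 \<longleftrightarrow> height a = height c"
    "\<exists>u. 10 dvd u \<and> height a + height c = 12 + 2 * u" by blast+
qed

text \<open>The pairs \<open>a, d\<close> and \<open>c, d\<close> have mean heights congruent modulo
  10, so the heights of \<open>a\<close> and \<open>c\<close> differ by a multiple of 20; being
  incomparable, they differ by at most 10.\<close>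

lemma no_three_incomparable:
  assumes "a \<in> P8" "c \<in> P8" "d \<in> P8" "colour a = colour c" "colour d = colour c"
    and "\<not> le P8 a c" "\<not> le P8 c a" "\<not> le P8 a d" "\<not> le P8 d a" "\<not> le P8 c d" "\<not> le P8 d c"
  shows "height a = height c"
proof -
  obtain v where v: "10 dvd v" "height a + height d = 12 + 2 * v"
    using incomparable(4)[of a d] assms by auto
  obtain w where w: "10 dvd w" "height c + height d = 12 + 2 * w"
    using incomparable(4)[of c d] assms by auto
  have "\<bar>height a - height c\<bar> \<le> 10" using incomparable(2)[of a c] assms by auto
  moreover have "height a - height c = 2 * (v - w)" using v w by simp
  ultimately show ?thesis using v(1) w(1) by presburger
qed

lemma four_incomparable:
  assumes "x \<in> P8" "y \<in> P8" "x \<noteq> y" "colour x = 4" "colour y = 4" "\<not> le P8 x y" "\<not> le P8 y x"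
  obtains u where "10 dvd u" "{x, y} = {half u, other u}"
proof -
  obtain u where u: "10 dvd u" "height x + height y = 12 + 2 * u"
    using incomparable(4)[of x y] assms by auto
  have "height x = height y" using incomparable(3)[of x y] assms by auto
  then have h: "height x = 6 + u" "height y = 6 + u" using u by auto
  show thesis using that[OF u(1)] level_6[OF u(1) assms(1) h(1)] level_6[OF u(1) assms(2) h(2)] assms(3) by auto
qed

section \<open>The block selected by an operator, and middles of strings\<close>

lemma card_2_obtain:
  assumes "card A = 2"
  obtains x y where "A = {x, y}" "x \<noteq> y"
  using assms by (auto simp: card_2_iff)

text \<open>The choice needs a witness for the selection rule. For colour 4 two addable blocks are
  incomparable, hence \<open>half u\<close> and \<open>other u\<close>, and the latter rests on a
  5-block.\<close>

lemma add_block_E8: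
  assumes "add_block E8 P8 j X = Some Y"
  shows "\<exists>c \<in> addable E8 P8 j X. Y = insert c X \<and>
    (card (addable E8 P8 j X) = 2 \<and> j \<noteq> 4 \<longrightarrow> (\<forall>d \<in> addable E8 P8 j X. height d \<le> height c))"
proof -
  let ?A = "addable E8 P8 j X"
  let ?Q = "\<lambda>b. b \<in> ?A \<and> (E8 = E8 \<and> card ?A = 2 \<longrightarrow>
     (if j = 4 then on_top_of P8 5 b else (\<forall>b'\<in>?A. height b' \<le> height b)))"
  have ne: "?A \<noteq> {}" using assms by (auto simp: add_block_def)
  then have "Some (insert (SOME b. ?Q b) X) = Some Y"
    using assms unfolding add_block_def Let_def by (simp only: if_False)
  then have Y: "Y = insert (SOME b. ?Q b) X" by simp
  have "\<exists>b. ?Q b"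
  proof (cases "card ?A = 2")
    case True
    then obtain x y where A: "?A = {x, y}" "x \<noteq> y" by (rule card_2_obtain)
    show ?thesis
    proof (cases "j = 4")
      case j: True
      have "x \<in> ?A" "y \<in> ?A" using A(1) by auto
      note xy = this addable_le[OF this A(2)] addable_le[OF this(2,1)] A(2)
      obtain u where "10 dvd u" "{x, y} = {half u, other u}"
        by (rule four_incomparable[of x y]) (use xy j in \<open>auto simp: addable_def\<close>)
      then show ?thesis using A on_top_special(1) j by (intro exI[of _ "other u"]) auto
    next
      case False
      show ?thesis
        by (rule exI[of _ "if height x \<le> height y then y else x"]) (use A False in auto)
    qed
  qed (use ne in auto)
  then obtain q where "q = (SOME b. ?Q b)" "?Q q" using someI_ex[of ?Q] by blast
  then show ?thesis using Y by (intro bexI[of _ q]) auto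
qed

lemma remove_block_E8:
  assumes "removable E8 P8 j X \<noteq> {}" and X: "X \<subseteq> P8"
  shows "\<exists>c \<in> removable E8 P8 j X. remove_block E8 P8 j X = Some (X - {c}) \<and>
    (card (removable E8 P8 j X) = 2 \<and> j \<noteq> 4 \<longrightarrow> (\<forall>d \<in> removable E8 P8 j X. height c \<le> height d))"
proof -
  let ?A = "removable E8 P8 j X"
  let ?Q = "\<lambda>b. b \<in> ?A \<and> (E8 = E8 \<and> card ?A = 2 \<longrightarrow>
     (if j = 4 then on_top_of P8 3 b else (\<forall>b'\<in>?A. height b \<le> height b')))"
  have Y: "remove_block E8 P8 j X = Some (X - {SOME b. ?Q b})"
    using assms(1) unfolding remove_block_def Let_def by (simp only: if_False)
  have "\<exists>b. ?Q b"
  proof (cases "card ?A = 2")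
    case True
    then obtain x y where A: "?A = {x, y}" "x \<noteq> y" by (rule card_2_obtain)
    show ?thesis
    proof (cases "j = 4")
      case j: True
      have "x \<in> ?A" "y \<in> ?A" using A(1) by auto
      note xy = this removable_le[OF this A(2)] removable_le[OF this(2,1)] A(2)
      obtain u where "10 dvd u" "{x, y} = {half u, other u}"
        by (rule four_incomparable[of x y]) (use xy j X in \<open>auto simp: removable_def\<close>)
      then show ?thesis using A on_top_special(2) j by (intro exI[of _ "half u"]) auto
    next
      case False
      show ?thesis
        by (rule exI[of _ "if height x \<le> height y then x else y"]) (use A False in auto)
    qed
  qed (use assms in auto)
  then obtain q where "q = (SOME b. ?Q b)" "?Q q" using someI_ex[of ?Q] by blast
  then show ?thesis using Y by (intro bexI[of _ q]) auto
qed

text \<open>A middle reached by adding \<open>c\<close> and one reached by removing \<open>a\<close>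
  yield the same data: a removable and an addable block of colour \<open>j\<close>. Only the column
  to which the selection rule applies differs.\<close>

lemma middleE:
  assumes "middle E8 P8 j Y" "Y \<in> young_columns E8 P8"
  obtains c a where "c \<in> removable E8 P8 j Y" "a \<in> addable E8 P8 j Y"
    "(card (addable E8 P8 j (Y - {c})) = 2 \<and> j \<noteq> 4 \<longrightarrow>
        (\<forall>d \<in> addable E8 P8 j (Y - {c}). height d \<le> height c)) \<or>
     (card (removable E8 P8 j (insert a Y)) = 2 \<and> j \<noteq> 4 \<longrightarrow>
        (\<forall>d \<in> removable E8 P8 j (insert a Y). height a \<le> height d))"
  using assms(1) unfolding middle_def
proof
  assume "(\<exists>X \<in> young_columns E8 P8. add_block E8 P8 j X = Some Y) \<and> addable E8 P8 j Y \<noteq> {}"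
  then obtain X a where X: "X \<in> young_columns E8 P8" "add_block E8 P8 j X = Some Y" "a \<in> addable E8 P8 j Y"
    by blast
  from add_block_E8[OF X(2)] obtain c where c: "c \<in> addable E8 P8 j X" "Y = insert c X"
    "card (addable E8 P8 j X) = 2 \<and> j \<noteq> 4 \<longrightarrow> (\<forall>d \<in> addable E8 P8 j X. height d \<le> height c)" by blast
  have "Y - {c} = X" using c(1,2) by (auto simp: addable_def)
  then show thesis using X c by (intro that[of c a]) (auto simp: removable_def addable_def)
next
  assume "(\<exists>X \<in> young_columns E8 P8. remove_block E8 P8 j X = Some Y) \<and> removable E8 P8 j Y \<noteq> {}"
  then obtain X c where X: "X \<in> young_columns E8 P8" "remove_block E8 P8 j X = Some Y" "c \<in> removable E8 P8 j Y"
    by blast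
  then have "removable E8 P8 j X \<noteq> {}" by (auto simp: remove_block_def Let_def split: if_splits)
  from remove_block_E8[OF this young_subset[OF X(1)]] X(2) obtain a where
    a: "a \<in> removable E8 P8 j X" "Y = X - {a}"
    "card (removable E8 P8 j X) = 2 \<and> j \<noteq> 4 \<longrightarrow> (\<forall>d \<in> removable E8 P8 j X. height a \<le> height d)" by auto
  have eq: "insert a Y = X" using a(1,2) by (auto simp: removable_def)
  have "a \<in> addable E8 P8 j Y"
    using a X(1) eq young_subset[OF X(1)] by (auto simp: removable_def addable_def)
  then show thesis using X(3) a(3) eq by (intro that[of c a]) auto
qed

text \<open>An ideal with \<open>half u\<close> contains \<open>two u\<close>, and one with
  \<open>upper u\<close> contains \<open>other u\<close>. Hence the added block can only be
  \<open>half u\<close> or \<open>upper u\<close> respectively.\<close>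

lemma insert_special:
  assumes "10 dvd u" "ideal P8 Y" "a \<notin> Y"
  shows "insert a Y = S1 u \<Longrightarrow> a = half u \<and> Y = filled P8 (5 + u) - {two u}"
    and "insert a Y = S2 u \<Longrightarrow> Y = Z u"
proof -
  note m = special_mem[OF assms(1)] and i = ideal_special[OF assms(1,2)]
  show "a = half u \<and> Y = filled P8 (5 + u) - {two u}" if S: "insert a Y = S1 u"
  proof -
    have "half u \<notin> Y" using i(1) S m(5) by auto
    then have "a = half u" using S by (auto simp: S1_def)
    moreover have "S1 u - {half u} = filled P8 (5 + u) - {two u}" using m(2) by (auto simp: S1_def)
    moreover have "Y = insert a Y - {a}" using assms(3) by simp
    ultimately show ?thesis using S by metis
  qed
  show "Y = Z u" if S: "insert a Y = S2 u"
  proof -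
    have "upper u \<notin> Y" using i(2) S m(8) by auto
    then have "a = upper u" using S by (auto simp: S2_def)
    moreover have "S2 u - {upper u} = Z u" using m(3,10) by (auto simp: S2_def Z_def)
    moreover have "Y = insert a Y - {a}" using assms(3) by simp
    ultimately show ?thesis using S by metis
  qed
qed

lemma remove_special:
  assumes "10 dvd u" "ideal P8 Y" "c \<in> Y"
  shows "Y - {c} = S1 u \<Longrightarrow> Y = Z u"
    and "Y - {c} = S2 u \<Longrightarrow> c = other u \<and> Y = insert (other u) (S2 u)"
proof -
  note m = special_mem[OF assms(1)] and i = ideal_special[OF assms(1,2)]
  show "Y = Z u" if S: "Y - {c} = S1 u"
  proof -
    have "half u \<in> Y" using S by (auto simp: S1_def)
    then have "two u \<in> Y" by (rule i(1))
    then have "c = two u" using S m(5) by auto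
    moreover have "insert (two u) (S1 u) = Z u" using m(1) by (auto simp: S1_def Z_def)
    moreover have "Y = insert c (Y - {c})" using assms(3) by (simp add: insert_absorb)
    ultimately show ?thesis using S by metis
  qed
  show "c = other u \<and> Y = insert (other u) (S2 u)" if S: "Y - {c} = S2 u"
  proof -
    have "upper u \<in> Y" using S by (auto simp: S2_def)
    then have "other u \<in> Y" by (rule i(2))
    then have "c = other u" using S m(8) by auto
    moreover have "Y = insert c (Y - {c})" using assms(3) by (simp add: insert_absorb)
    ultimately show ?thesis using S by metis
  qed
qed

text \<open>With \<open>Z u\<close> excluded, a special column could arise only by removing
  \<open>other u\<close> or adding \<open>half u\<close>. Both have colour 4, and then no partner of
  colour 4 exists on the other side.\<close>

lemma both_ideal:
  assumes Y: "ideal P8 Y" "\<And>u. 10 dvd u \<Longrightarrow> Y \<noteq> Z u"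
    and c: "c \<in> removable E8 P8 j Y" and a: "a \<in> addable E8 P8 j Y"
  shows "ideal P8 (Y - {c})" "ideal P8 (insert a Y)"
proof -
  have c': "c \<in> Y" "colour c = j" "Y - {c} \<in> young_columns E8 P8" using c by (auto simp: removable_def)
  have a': "a \<in> P8" "a \<notin> Y" "colour a = j" "insert a Y \<in> young_columns E8 P8" using a by (auto simp: addable_def)
  have a_below: "d \<in> Y" if "ideal P8 (insert a Y)" "(d, a) \<in> below P8" for d
    using ideal_below[OF that(1) _ that(2)] that(2) by (auto simp: below_def)
  show 1: "ideal P8 (Y - {c})"
    using c'(3)
  proof (cases rule: young_E8_cases)
    case (2 u)
    then show ?thesis using remove_special(1)[OF 2(1) Y(1) c'(1)] Y(2) by blast
  next
    case (3 u)
    have Yeq: "c = other u" "Y = insert (other u) (S2 u)"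
      using remove_special(2)[OF 3(1) Y(1) c'(1) 3(2)] by auto
    have hY: "height b \<le> 7 + u" if "b \<in> Y" for b using that height_S(2)[of b u] Yeq(2) by auto
    have Y7: "b = upper u" if "b \<in> Y" "height b = 7 + u" for b
      using that Yeq(2) by (auto simp: S2_def filled_def)
    have j: "j = 4" using Yeq(1) c'(2) by simp
    have False
      using a'(4)
    proof (cases rule: young_E8_cases)
      case 1
      have "height a > 6 + u"
      proof (rule ccontr)
        assume "\<not> height a > 6 + u"
        then have "height a = 6 + u \<or> height a \<le> 5 + u" by auto
        then have "a \<in> Y" using level_6[OF 3(1) a'(1)] a'(1) Yeq(2) by (auto simp: S2_def filled_def)
        then show False using a'(2) by simp
      qed
      show False
      proof (cases "height a \<le> 8 + u")
        case True
        then obtain d where "(d, a) \<in> below P8" "height d = 7 + u" "d \<noteq> upper u"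
          using four_level_8[OF 3(1) a'(1) \<open>height a > 6 + u\<close>] a'(3) j by auto
        then show False using a_below[OF 1] Y7 by blast
      next
        case False
        \<comment> \<open>The depth 11 guarantees a block below \<open>a\<close>, hence one directly
          below it, which is too high to lie in \<open>Y\<close>.\<close>
        obtain e where e: "e \<in> P8" "height e = height a - 11" using E8.level_nonempty by blast
        then have "le P8 e a" using E8.full_le[OF a'(1) e(1)] by simp
        moreover have "e \<noteq> a" using e(2) by auto
        ultimately obtain d where "(d, a) \<in> below P8" by (metis rtranclE)
        then show False using a_below[OF 1] hY[of d] False by (auto simp: below_def)
      qed
    next
      case (2 v)
      have Yv: "Y = filled P8 (5 + v) - {two v}" using insert_special(1)[OF 2(1) Y(1) a'(2) 2(2)] by simp
      have "half u \<in> Y" using Yeq(2) by (simp add: S2_def)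
      then have "6 + u \<le> 5 + v" using Yv by (auto simp: filled_def)
      then have "u + 10 \<le> v" using 2(1) 3(1) by presburger
      obtain e where "e \<in> P8" "height e = 8 + u" using E8.level_nonempty by blast
      then have "e \<in> Y" using \<open>u + 10 \<le> v\<close> unfolding Yv by (auto simp: filled_def)
      then show False using hY \<open>height e = 8 + u\<close> by fastforce
    next
      case (3 v)
      then show False using insert_special(2)[OF 3(1) Y(1) a'(2)] Y(2) by blast
    qed
    then show ?thesis ..
  qed
  show "ideal P8 (insert a Y)"
    using a'(4)
  proof (cases rule: young_E8_cases)
    case (2 u)
    have Yu: "a = half u" "Y = filled P8 (5 + u) - {two u}" using insert_special(1)[OF 2(1) Y(1) a'(2) 2(2)] by auto
    have "c \<in> P8" "height c \<le> 5 + u" using c'(1) Yu(2) by (auto simp: filled_def)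
    moreover have "colour c = 4" using c'(2) a'(3) Yu(1) by simp
    ultimately obtain d where d: "d \<in> P8" "(c, d) \<in> below P8" "height d \<le> 5 + u" "d \<noteq> two u"
      using four_level_4[OF 2(1)] by blast
    then have "d \<in> Y - {c}" using Yu(2) by (auto simp: filled_def below_def)
    then show ?thesis using ideal_below[OF 1 _ d(2)] by blast
  next
    case (3 u)
    then show ?thesis using insert_special(2)[OF 3(1) Y(1) a'(2)] Y(2) by blast
  qed
qed

text \<open>If \<open>Y\<close> is the middle of a \<open>j\<close>-string, then there are incomparable blocks \<open>a\<close> (addable) and \<open>c\<close>
  (removable) of colour \<open>j\<close>.  The selection rule forces \<open>a\<close> to be at most as high as \<open>c\<close>, and then
  every other block at least as high as \<open>c\<close> has one of the two below it.\<close>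

lemma no_middle:
  assumes Y: "ideal P8 Y" "\<And>u. 10 dvd u \<Longrightarrow> Y \<noteq> Z u"
    and b: "b \<in> Y" "\<And>d. d \<in> Y \<Longrightarrow> height d \<le> height b" "colour b \<noteq> j"
  shows "\<not> middle E8 P8 j Y"
proof
  assume "middle E8 P8 j Y"
  then obtain c a where c: "c \<in> removable E8 P8 j Y" and a: "a \<in> addable E8 P8 j Y" and rule:
    "(card (addable E8 P8 j (Y - {c})) = 2 \<and> j \<noteq> 4 \<longrightarrow>
        (\<forall>d \<in> addable E8 P8 j (Y - {c}). height d \<le> height c)) \<or>
     (card (removable E8 P8 j (insert a Y)) = 2 \<and> j \<noteq> 4 \<longrightarrow>
        (\<forall>d \<in> removable E8 P8 j (insert a Y). height a \<le> height d))"
    by (rule middleE[OF _ ideal_young[OF Y(1)]])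
  note ideals = both_ideal[OF Y c a]
  have YP: "Y \<subseteq> P8" using Y(1) by (simp add: ideal_def)
  have c': "c \<in> Y" "colour c = j" "c \<in> P8" using c YP by (auto simp: removable_def)
  have a': "a \<in> P8" "a \<notin> Y" "colour a = j" using a by (auto simp: addable_def)
  have ac: "\<not> le P8 a c" using ideal_le[OF Y(1)] a'(2) c'(1) by blast
  have ca: "\<not> le P8 c a"
  proof
    assume "le P8 c a"
    moreover have "c \<noteq> a" using a' c' by auto
    ultimately obtain d where d: "(c, d) \<in> below P8" "le P8 d a" by (rule le_stepE)
    \<comment> \<open>By parity the block \<open>d\<close> directly over \<open>c\<close> cannot be
      \<open>a\<close>; so \<open>d\<close> is in \<open>Y\<close> and prevents the removal of
      \<open>c\<close>.\<close>
    have "d \<noteq> a" using d(1) colour_parity[OF c'(3)] colour_parity[OF a'(1)] a'(3) c'(2)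
      by (auto simp: below_def)
    then have "d \<in> Y - {c}" using ideal_le[OF ideals(2) d(2)] d(1) by (auto simp: below_def)
    then show False using ideal_below[OF ideals(1) _ d(1)] by blast
  qed
  have inc: "height a = height c \<longleftrightarrow> j = 4" using incomparable(3)[OF a'(1) c'(3) _ ac ca] a'(3) c'(2) by auto
  show False
  proof (cases "height a \<le> height c")
    case True
    have "\<not> le P8 c b"
      using ideal_le[OF ideals(1), of c b] b(1,3) c'(2) by auto
    then have "le P8 a b" using E8.triples[of b c a] b YP c' a' ac True by auto
    then show False using ideal_le[OF Y(1)] b(1) a'(2) by blast
  next
    case False
    obtain K where K: "\<forall>b\<in>Y. height b \<le> K" using Y(1) by (auto simp: ideal_def)
    \<comment> \<open>Exchanging \<open>c\<close> for the higher \<open>a\<close> gives an ideal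
      again. So both are addable to \<open>Y - {c}\<close> and removable from
      \<open>insert a Y\<close>, with no third candidate, and in either situation the rule prefers
      the other block.\<close>
    have swap: "ideal P8 (insert a (Y - {c}))"
    proof (rule idealI)
      show "height e \<le> max K (height a)" if "e \<in> insert a (Y - {c})" for e using K that by fastforce
      show "f \<in> insert a (Y - {c})" if "e \<in> insert a (Y - {c})" "(f, e) \<in> below P8" for e f
      proof -
        have "f \<noteq> c"
        proof
          assume f: "f = c"
          then have "e \<noteq> a" using that(2) ca by auto
          then show False using that ideal_below[OF ideals(1) _ that(2)] f by blast
        qed
        moreover have "f \<in> insert a Y" using ideal_below[OF ideals(2) _ that(2)] that(1) by blast
        ultimately show ?thesis by blast
      qed
    qed (use YP a' in auto)
    have "c \<noteq> a" using a' c' by auto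
    have three: False if "d \<in> P8" "colour d = j" "\<not> le P8 a d" "\<not> le P8 d a" "\<not> le P8 c d" "\<not> le P8 d c" for d
      using no_three_incomparable[of a c d] that a' c' ac ca False by auto
    have "insert c (Y - {c}) = Y" using c'(1) by blast
    then have A: "c \<in> addable E8 P8 j (Y - {c})" "a \<in> addable E8 P8 j (Y - {c})"
      using c' a' ideal_young[OF Y(1)] ideal_young[OF swap] by (auto simp: addable_def)
    have "d \<in> {a, c}" if d: "d \<in> addable E8 P8 j (Y - {c})" for d
      using three[of d] addable_le[OF d A(1)] addable_le[OF A(1) d] addable_le[OF d A(2)] addable_le[OF A(2) d]
        d by (auto simp: addable_def)
    then have "addable E8 P8 j (Y - {c}) = {a, c}" using A by blast
    then have 1: "card (addable E8 P8 j (Y - {c})) = 2" using \<open>c \<noteq> a\<close> by simp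
    have "insert a Y - {a} = Y" "insert a Y - {c} = insert a (Y - {c})" using a'(2) \<open>c \<noteq> a\<close> by auto
    then have R: "c \<in> removable E8 P8 j (insert a Y)" "a \<in> removable E8 P8 j (insert a Y)"
      using c' a' ideal_young[OF Y(1)] ideal_young[OF swap] by (auto simp: removable_def)
    have "d \<in> {a, c}" if d: "d \<in> removable E8 P8 j (insert a Y)" for d
      using three[of d] removable_le[OF d R(1)] removable_le[OF R(1) d] removable_le[OF d R(2)] removable_le[OF R(2) d]
        d YP a'(1) by (auto simp: removable_def)
    then have "removable E8 P8 j (insert a Y) = {a, c}" using R by blast
    then have 2: "card (removable E8 P8 j (insert a Y)) = 2" using \<open>c \<noteq> a\<close> by simp
    have "j \<noteq> 4" using inc False by auto
    then show False using rule 1 2 A R False by auto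
  qed
qed

text \<open>The operator for the colour of a highest block \<open>b\<close> may remove another block
  \<open>d\<close>. The point is that \<open>d\<close> still lies above \<open>K\<close>, so that
  the induction proceeds.\<close>

lemma descent_step:
  assumes Y: "ideal P8 Y" "\<And>u. 10 dvd u \<Longrightarrow> Y \<noteq> Z u" and K: "10 dvd K" "filled P8 K \<subset> Y"
  shows "\<exists>d \<in> Y. d \<notin> filled P8 K \<and> Y - {d} \<in> young_columns E8 P8 \<and>
    col_e E8 P8 (colour d) Y = Some (Y - {d})"
proof -
  obtain b where b: "b \<in> Y" "K < height b" "\<And>d. d \<in> Y \<Longrightarrow> height d \<le> height b"
    using E8.ideal_top[OF Y(1) K(2)] by metis
  have YP: "Y \<subseteq> P8" using Y(1) by (simp add: ideal_def)
  have sub: "filled P8 K \<subseteq> Y" using K(2) by blast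
  have "ideal P8 (Y - {b})" by (rule E8.ideal_remove_top[OF Y(1) b(1,3) sub b(2)])
  then have bR: "b \<in> removable E8 P8 (colour b) Y"
    using b(1) by (auto simp: removable_def intro: ideal_young)
  then obtain d where d: "d \<in> removable E8 P8 (colour b) Y"
    "remove_block E8 P8 (colour b) Y = Some (Y - {d})"
    using remove_block_E8[OF _ YP] by blast
  have d': "d \<in> Y" "colour d = colour b" "Y - {d} \<in> young_columns E8 P8"
    using d(1) by (auto simp: removable_def)
  have "col_e E8 P8 (colour d) Y = Some (Y - {d})"
    using no_middle[OF Y b(1,3)] d(2) d'(2) by (auto simp: col_e_def)
  moreover have "d \<notin> filled P8 K"
  proof
    assume "d \<in> filled P8 K"
    then have dK: "d \<in> P8" "height d \<le> K" by (auto simp: filled_def)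
    then have "d \<noteq> b" using b(2) by auto
    note inc = incomparable[OF dK(1) _ d'(2) removable_le[OF d(1) bR this] removable_le[OF bR d(1) this[symmetric]]]
    have bP: "b \<in> P8" using b(1) YP by blast
    \<comment> \<open>If \<open>d\<close> were lower, a block covering it would also lie in
      \<open>filled P8 K\<close> and keep \<open>d\<close> from being removed.\<close>
    have "height d = K"
      using d'(3)
    proof (cases rule: young_E8_cases)
      case 1
      obtain e where e: "e \<in> P8" "height e = height d + 1" "(d, e) \<in> below P8"
        using E8.cover[OF dK(1)] by blast
      show ?thesis
      proof (rule ccontr)
        assume "height d \<noteq> K"
        then have "e \<in> filled P8 K" using e dK by (auto simp: filled_def)
        then have "e \<in> Y - {d}" using sub e(2) by auto
        then show False using ideal_below[OF 1 _ e(3)] by blast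
      qed
    next
      case (2 u)
      then show ?thesis using remove_special(1)[OF 2(1) Y(1) d'(1)] Y(2) by blast
    next
      case (3 u)
      then have "colour d = 4" using remove_special(2)[OF 3(1) Y(1) d'(1)] by auto
      then show ?thesis using inc(3)[OF bP] b(2) dK(2) by auto
    qed
    moreover obtain u where "10 dvd u" "height d + height b = 12 + 2 * u" using inc(4)[OF bP] by blast
    moreover have "height b \<le> height d + 10" using inc(2)[OF bP] by simp
    \<comment> \<open>The mean height \<open>6 + u\<close> would be greater than \<open>K\<close>
      and at most \<open>K + 5\<close>, although 10 divides both \<open>u\<close> and
      \<open>K\<close>.\<close>
    ultimately show False using K(1) b(2) by presburger
  qed
  ultimately show ?thesis using d' by blast
qed

section \<open>Operators on the special columns\<close>

lemma filled_subset_S: "filled P8 (4 + u) \<subseteq> S1 u" "filled P8 (4 + u) \<subseteq> S2 u"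
  by (auto simp: S1_def S2_def filled_def)

lemma special_far:
  assumes "10 dvd u" "10 dvd v" "u < v"
  shows "two u \<in> filled P8 (4 + v)" "other u \<in> filled P8 (4 + v)"
proof -
  have "u + 10 \<le> v" using assms by presburger
  then show "two u \<in> filled P8 (4 + v)" "other u \<in> filled P8 (4 + v)"
    using S_subset[OF assms(1)] by (auto simp: filled_def)
qed

text \<open>Different centres are at least 10 levels apart. For \<open>u < v\<close> the column
  \<open>R\<close> contains \<open>other u\<close>, which \<open>S\<close> lacks; for
  \<open>v < u\<close> it misses at least two blocks of \<open>S\<close>.\<close>

lemma special_remove_special:
  assumes u: "10 dvd u" and v: "10 dvd v"
    and S: "S = S1 u \<or> S = S2 u" and R: "R = S1 v \<or> R = S2 v"
    and "d \<in> S" "S - {d} = R"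
  shows "v = u"
proof -
  note m = special_mem[OF u]
  have "\<not> u < v"
  proof
    assume "u < v"
    then have "other u \<in> R" using special_far(2)[OF u v] filled_subset_S[of v] R by blast
    then show False using assms(6) S m(7,8) by blast
  qed
  moreover have "\<not> v < u"
  proof
    assume "v < u"
    then have "v + 10 \<le> u" using u v by presburger
    then have R': "height b \<le> u - 3" if "b \<in> R" for b using R height_S[of b v] that by fastforce
    obtain e where e: "e \<in> P8" "height e = 4 + u" using E8.level_nonempty by blast
    then have "e \<in> S" using S filled_subset_S[of u] by (auto simp: filled_def)
    moreover have "half u \<in> S" using S by (auto simp: S1_def S2_def)
    moreover have "e \<noteq> half u" using e(2) by auto
    ultimately have "e \<in> R \<or> half u \<in> R" using assms(6) by blast
    then show False using R'[of e] R'[of "half u"] e(2) by auto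
  qed
  ultimately show ?thesis by simp
qed

lemma removable_S1:
  assumes u: "10 dvd u" and d: "d \<in> removable E8 P8 j (S1 u)"
  shows "d = half u"
proof -
  note m = special_mem[OF u]
  have d': "d \<in> S1 u" "S1 u - {d} \<in> young_columns E8 P8" using d by (auto simp: removable_def)
  show ?thesis
    using d'(2)
  proof (cases rule: young_E8_cases)
    case 1
    then show ?thesis using ideal_special(1)[OF u 1] m(5) by (auto simp: S1_def)
  next
    case (2 v)
    then show ?thesis using special_remove_special[OF u 2(1) _ _ d'(1) 2(2)] d'(1) by auto
  next
    case (3 v)
    then have "v = u" using special_remove_special[OF u 3(1) _ _ d'(1) 3(2)] by auto
    then have "upper u \<in> S1 u" using 3(2) by (auto simp: S2_def)
    then show ?thesis using m(6) by simp
  qed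
qed

lemma removable_S2:
  assumes u: "10 dvd u" and d: "d \<in> removable E8 P8 j (S2 u)"
  shows "d = upper u"
proof -
  note m = special_mem[OF u]
  have d': "d \<in> S2 u" "S2 u - {d} \<in> young_columns E8 P8" using d by (auto simp: removable_def)
  show ?thesis
    using d'(2)
  proof (cases rule: young_E8_cases)
    case 1
    then show ?thesis using ideal_special(2)[OF u 1] m(8) by (auto simp: S2_def)
  next
    case (2 v)
    then have "v = u" using special_remove_special[OF u 2(1) _ _ d'(1) 2(2)] by auto
    then have "S2 u - {d} = S1 u" using 2(2) by simp
    moreover have "upper u \<in> S2 u" by (simp add: S2_def)
    ultimately show ?thesis using m(6) by blast
  next
    case (3 v)
    then show ?thesis using special_remove_special[OF u 3(1) _ _ d'(1) 3(2)] d'(1) by auto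
  qed
qed

lemma addable_S1:
  assumes u: "10 dvd u" and a: "a \<in> addable E8 P8 j (S1 u)"
  shows "a = two u"
proof -
  note m = special_mem[OF u]
  have a': "a \<notin> S1 u" "insert a (S1 u) \<in> young_columns E8 P8" using a by (auto simp: addable_def)
  have half: "half u \<in> S1 u" by (simp add: S1_def)
  show ?thesis
    using a'(2)
  proof (cases rule: young_E8_cases)
    case 1
    then show ?thesis using ideal_special(1)[OF u 1] m(5) half by auto
  next
    case (2 v)
    then have eq: "S1 v - {a} = S1 u" using a'(1) by (metis Diff_insert_absorb)
    have "a \<in> S1 v" using 2(2) by blast
    then have "u = v" using special_remove_special[OF 2(1) u _ _ _ eq] by blast
    then show ?thesis using \<open>a \<in> S1 v\<close> a'(1) by simp
  next
    case (3 v)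
    then have eq: "S2 v - {a} = S1 u" using a'(1) by (metis Diff_insert_absorb)
    have "a \<in> S2 v" using 3(2) by blast
    then have "u = v" using special_remove_special[OF 3(1) u _ _ _ eq] by blast
    then have "two u \<in> insert a (S1 u)" using 3(2) m(1) by (auto simp: S2_def)
    then show ?thesis using m(5) by simp
  qed
qed

text \<open>The middle of a \<open>j\<close>-string has a removable block of colour
  \<open>j\<close>. Only \<open>half u\<close> is removable here, so no string of another colour
  annihilates the step.\<close>

lemma col_e_S1:
  assumes u: "10 dvd u"
  shows "col_e E8 P8 4 (S1 u) = Some (S1 u - {half u})" "S1 u - {half u} \<in> young_columns E8 P8"
proof -
  note m = special_mem[OF u]
  have eq: "S1 u - {half u} = filled P8 (5 + u) - {two u}" using m(2) by (auto simp: S1_def)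
  show y: "S1 u - {half u} \<in> young_columns E8 P8"
    unfolding eq by (rule ideal_young[OF ideal_lower])
  have "half u \<in> removable E8 P8 4 (S1 u)" using y by (simp add: removable_def S1_def)
  then have "remove_block E8 P8 4 (S1 u) = Some (S1 u - {half u})"
    using remove_block_E8[OF _ S_subset(5)[OF u]] removable_S1[OF u] by blast
  moreover have "\<not> middle E8 P8 j (S1 u)" if "j \<noteq> 4" for j
  proof
    assume "middle E8 P8 j (S1 u)"
    then obtain c where "c \<in> removable E8 P8 j (S1 u)" using middleE[OF _ S1_young[OF u]] by metis
    then have "c = half u" "colour c = j" using removable_S1[OF u] by (blast, simp add: removable_def)
    then show False using that by simp
  qed
  ultimately show "col_e E8 P8 4 (S1 u) = Some (S1 u - {half u})" by (auto simp: col_e_def)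
qed

lemma col_e_S2:
  assumes u: "10 dvd u"
  shows "col_e E8 P8 2 (S2 u) = Some (S2 u - {upper u})" "S2 u - {upper u} \<in> young_columns E8 P8"
proof -
  note m = special_mem[OF u]
  have eq: "S2 u - {upper u} = Z u" using m(3,10) by (auto simp: S2_def Z_def)
  show y: "S2 u - {upper u} \<in> young_columns E8 P8"
    unfolding eq by (rule ideal_young[OF ideal_Z[OF u]])
  have "upper u \<in> removable E8 P8 2 (S2 u)" using y by (simp add: removable_def S2_def)
  then have "remove_block E8 P8 2 (S2 u) = Some (S2 u - {upper u})"
    using remove_block_E8[OF _ S_subset(6)[OF u]] removable_S2[OF u] by blast
  moreover have "\<not> middle E8 P8 j (S2 u)" if "j \<noteq> 2" for j
  proof
    assume "middle E8 P8 j (S2 u)"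
    then obtain c where "c \<in> removable E8 P8 j (S2 u)" using middleE[OF _ S2_young[OF u]] by metis
    then have "c = upper u" "colour c = j" using removable_S2[OF u] by (blast, simp add: removable_def)
    then show False using that by simp
  qed
  ultimately show "col_e E8 P8 2 (S2 u) = Some (S2 u - {upper u})" by (auto simp: col_e_def)
qed

text \<open>This is the step down from \<open>Z u\<close>, read upwards: \<open>S1 u\<close> has
  \<open>two u\<close> as its only addable block, so the choice is forced and a middle of another
  colour is excluded.\<close>

lemma col_f_S1:
  assumes u: "10 dvd u"
  shows "Z u - {two u} = S1 u" "col_f E8 P8 2 (S1 u) = Some (Z u)"
proof -
  note m = special_mem[OF u]
  show eq: "Z u - {two u} = S1 u" using m(9) by (auto simp: S1_def Z_def)
  have two: "two u \<in> Z u" using m(1) by (simp add: Z_def)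
  then have ins: "insert (two u) (S1 u) = Z u" using eq by blast
  then have "two u \<in> addable E8 P8 2 (S1 u)"
    using ideal_young[OF ideal_Z[OF u]] m(5) S_subset(2)[OF u] by (simp add: addable_def)
  then have "add_block E8 P8 2 (S1 u) \<noteq> None" by (auto simp: add_block_def Let_def)
  then have "add_block E8 P8 2 (S1 u) = Some (Z u)"
    using add_block_E8[of 2 "S1 u"] addable_S1[OF u] ins by fastforce
  moreover have "\<not> middle E8 P8 j (S1 u)" if "j \<noteq> 2" for j
  proof
    assume "middle E8 P8 j (S1 u)"
    then obtain a where "a \<in> addable E8 P8 j (S1 u)" using middleE[OF _ S1_young[OF u]] by metis
    then have "a = two u" "colour a = j" using addable_S1[OF u] by (blast, simp add: addable_def)
    then show False using that by simp
  qed
  ultimately show "col_f E8 P8 2 (S1 u) = Some (Z u)" by (auto simp: col_f_def)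
qed

lemma descends_E8:
  assumes "10 dvd K" "Y \<in> young_columns E8 P8" "filled P8 K \<subseteq> Y"
  shows "descends E8 P8 Y (filled P8 K)"
  using assms(2,3)
proof (induction "card (Y - filled P8 K)" arbitrary: Y rule: less_induct)
  case less
  note YP = young_subset[OF less.prems(1)]
  have bounded: "\<exists>h. \<forall>b \<in> Y. height b \<le> h"
    using less.prems(1)
  proof (cases rule: young_E8_cases)
    case (2 u)
    then show ?thesis using height_S(1) by blast
  next
    case (3 u)
    then show ?thesis using height_S(2) by blast
  qed (auto simp: ideal_def)
  then have fin: "finite (Y - filled P8 K)" using E8.finite_minus_filled[OF YP] by blast
  have step: "descends E8 P8 Y (filled P8 K)"
    if d: "d \<in> Y" "d \<notin> filled P8 K" "Y - {d} \<in> young_columns E8 P8"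
      "col_e E8 P8 (colour d) Y = Some (Y - {d}) \<or> col_f E8 P8 (colour d) (Y - {d}) = Some Y" for d
  proof (rule descends.step[OF d(1) _ less.prems(1) d(3,4)])
    show "colour d \<le> rank E8" using E8.colour_le_rank d(1) YP by blast
    have "Y - {d} - filled P8 K \<subset> Y - filled P8 K" using d(1,2) by blast
    then show "descends E8 P8 (Y - {d}) (filled P8 K)"
      using less.hyps[OF psubset_card_mono[OF fin] d(3)] less.prems(2) d(2) by blast
  qed
  \<comment> \<open>\<open>Y\<close> has a block of height \<open>K\<close>, so
    \<open>K \<le> 7 + u\<close>; as both are multiples of 10, \<open>K \<le> u\<close>. The special
    blocks to be removed therefore lie above \<open>K\<close>.\<close>
  have low: "K \<le> u" if "10 dvd u" "\<And>b. b \<in> Y \<Longrightarrow> height b \<le> 7 + u" for u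
  proof -
    obtain e where "e \<in> P8" "height e = K" using E8.level_nonempty by blast
    then have "e \<in> Y" using less.prems(2) by (auto simp: filled_def)
    then have "K \<le> 7 + u" using that(2) \<open>height e = K\<close> by auto
    then show ?thesis using that(1) assms(1) by presburger
  qed
  from less.prems(1) show ?case
  proof (cases rule: young_E8_cases)
    case 1
    consider "Y = filled P8 K" | u where "10 dvd u" "Y = Z u"
      | "filled P8 K \<subset> Y" "\<And>u. 10 dvd u \<Longrightarrow> Y \<noteq> Z u" using less.prems(2) by blast
    then show ?thesis
    proof cases
      case (2 u)
      have "K \<le> u" by (rule low[OF 2(1)]) (auto simp: 2 Z_def filled_def)
      then have "two u \<notin> filled P8 K" by (auto simp: filled_def)
      moreover have "two u \<in> Y" using special_mem(1)[OF 2(1)] 2(2) by (simp add: Z_def)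
      ultimately show ?thesis
        using step[of "two u"] col_f_S1[OF 2(1)] S1_young[OF 2(1)] 2(2) by simp
    next
      case 3
      then show ?thesis using descent_step[OF 1 3(2) assms(1) 3(1)] step by blast
    qed (simp add: descends.refl)
  next
    case (2 u)
    have "K \<le> u" by (rule low[OF 2(1)]) (use 2 height_S(1) in fastforce)
    then have "half u \<notin> filled P8 K" by (auto simp: filled_def)
    then show ?thesis using step[of "half u"] col_e_S1[OF 2(1)] 2(2) by (simp add: S1_def)
  next
    case (3 u)
    have "K \<le> u" by (rule low[OF 3(1)]) (use 3 height_S(2) in fastforce)
    then have "upper u \<notin> filled P8 K" by (auto simp: filled_def)
    then show ?thesis using step[of "upper u"] col_e_S2[OF 3(1)] 3(2) by (simp add: S2_def)
  qed
qed

section \<open>Degrees\<close>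

lemma contains_filled:
  assumes "Y \<in> young_columns T (wall_pattern T r)"
  obtains K where "filled (wall_pattern T r) K \<subseteq> Y"
proof -
  interpret level_table T "wall_pattern T r" "offset T r" "wall_level T r" "wall_block T r"
    by (rule level_table_wall)
  show thesis
  proof (cases "ideal (wall_pattern T r) Y")
    case True
    then show ?thesis using ideal_contains_filled that by blast
  next
    case False
    then have "T = E8" using assms by (auto simp: young_columns_eq)
    then have P: "wall_pattern T r = P8" "Y \<in> young_columns E8 P8"
      using assms by (simp_all add: wall_pattern_E8)
    from P(2) show ?thesis
    proof (cases rule: young_E8_cases)
      case 1
      then show ?thesis using False P(1) by simp
    next
      case (2 u)
      then show ?thesis using that filled_subset_S(1)[of u] P(1) by simp
    next
      case (3 u)
      then show ?thesis using that filled_subset_S(2)[of u] P(1) by simp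
    qed
  qed
qed

lemma descends_wall:
  assumes "Y \<in> young_columns T (wall_pattern T r)" "10 dvd K" "filled (wall_pattern T r) K \<subseteq> Y"
  shows "descends T (wall_pattern T r) Y (filled (wall_pattern T r) K)"
proof (cases "T = E8")
  case True
  then show ?thesis using descends_E8 assms by (simp add: wall_pattern_E8)
next
  case False
  interpret level_table T "wall_pattern T r" "offset T r" "wall_level T r" "wall_block T r"
    by (rule level_table_wall)
  show ?thesis using descends_chain[OF False] assms False by (simp add: young_columns_eq)
qed

text \<open>Three columns shift the E6 pattern by 24, two periods of 12, and the E7 columns
  alternate; 6 serves both.\<close>

lemma wall_pattern_periodic: "wall_pattern T (r + 6 * j) = wall_pattern T r"
proof -
  have "wall_cube T (r + 6 * j) k = wall_cube T r k" for k
  proof (cases T)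
    case E6
    have "k + offset E6 (r + 6 * j) = k + offset E6 r + 12 * (4 * int j)" by simp
    then have "(k + offset E6 (r + 6 * j)) mod 12 = (k + offset E6 r) mod 12"
      by (simp only: mod_mult_self2)
    then show ?thesis using E6 by (simp only: wall_cube_eq) simp
  qed auto
  then show ?thesis by (simp add: wall_pattern_def)
qed

text \<open>A Young wall agrees with the ground state in all sufficiently distant columns, where the
  ground column is therefore a Young column; periodicity carries this back to column
  \<open>r\<close>.\<close>

lemma ground_column_young:
  assumes "Y \<in> young_walls T"
  shows "ground_column T r \<in> young_columns T (wall_pattern T r)"
proof -
  let ?D = "{(r, b). b \<in> (Y r - ground_column T r) \<union> (ground_column T r - Y r)}"
  have "finite (fst ` ?D)" using assms by (simp add: young_walls_def)
  then obtain N where N: "\<forall>x \<in> fst ` ?D. x \<le> N" by (meson finite_nat_set_iff_bounded_le)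
  define r' where "r' = r + 6 * Suc N"
  have "r' \<notin> fst ` ?D"
  proof
    assume "r' \<in> fst ` ?D"
    then have "r' \<le> N" using N by blast
    then show False by (simp add: r'_def)
  qed
  then have "Y r' = ground_column T r'" by force
  moreover have "Y r' \<in> young_columns T (wall_pattern T r')" using assms by (simp add: young_walls_def)
  moreover have "wall_pattern T r' = wall_pattern T r" unfolding r'_def by (rule wall_pattern_periodic)
  ultimately show ?thesis by (simp add: ground_column_def)
qed

lemma degree_eq:
  assumes F: "column_identification T m r F" and Y: "Y \<in> young_walls T"
  shows "fst (F (Y r)) = m r - zero_diff T r (Y r)"
proof -
  let ?P = "wall_pattern T r" and ?G = "ground_column T r"
  have Yr: "Y r \<in> young_columns T ?P" using Y by (simp add: young_walls_def)
  have G: "?G \<in> young_columns T ?P" by (rule ground_column_young[OF Y])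
  obtain K1 K2 where K12: "filled ?P K1 \<subseteq> Y r" "filled ?P K2 \<subseteq> ?G"
    using contains_filled[OF Yr] contains_filled[OF G] by metis
  \<comment> \<open>Rounding down to a multiple of 10 keeps \<open>filled ?P K\<close> inside both
    columns and meets the condition of the descent.\<close>
  define K where "K = 10 * (min K1 K2 div 10)"
  have "K \<le> K1" "K \<le> K2" using pos_mod_sign[of 10 "min K1 K2"]
    by (auto simp: K_def minus_mod_eq_mult_div[symmetric] simp del: pos_mod_sign)
  then have K: "filled ?P K \<subseteq> Y r" "filled ?P K \<subseteq> ?G" using K12 by (force simp: filled_def)+
  have "10 dvd K" by (simp add: K_def)
  let ?D = "{(r, b). b \<in> (Y r - ground_column T r) \<union> (ground_column T r - Y r)}"
  have "finite (snd ` ?D)" using Y by (simp add: young_walls_def)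
  then have fin: "finite (Y r - ?G)" "finite (?G - Y r)"
    by (rule finite_subset[rotated], force)+
  have "fst (F (Y r)) + zero_diff T r (Y r) = fst (F (filled ?P K)) + zero_diff T r (filled ?P K)"
    by (rule degree_descends[OF F descends_wall[OF Yr \<open>10 dvd K\<close> K(1)] fin])
  moreover have "fst (F ?G) + zero_diff T r ?G = fst (F (filled ?P K)) + zero_diff T r (filled ?P K)"
    by (rule degree_descends[OF F descends_wall[OF G \<open>10 dvd K\<close> K(2)]]) simp_all
  moreover have "zero_diff T r ?G = 0" by (simp add: zero_diff_def)
  moreover have "fst (F ?G) = m r" using F by (simp add: column_identification_def)
  ultimately show ?thesis by simp
qed

theorem proposition5p4:
  fixes T :: affine_type
    and H :: "young_class \<times> young_class \<Rightarrow> int"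
    and m :: "nat \<Rightarrow> int"
    and F :: "nat \<Rightarrow> block set \<Rightarrow> int \<times> young_class"
    and Y :: "nat \<Rightarrow> block set"
    and n :: "nat \<Rightarrow> int"
    and y :: "nat \<Rightarrow> young_class"
  assumes "energy_function T H"
    and "ground_degrees T H m"
    and "\<forall>r. column_identification T m r (F r)"
    and "Y \<in> young_walls T"
    and "\<forall>r. F r (Y r) = (n r, y r)"
  shows "Y \<in> Z_Lambda0 T H F \<longleftrightarrow>
    (\<forall>r. zero_diff T r (Y r) >
         zero_diff T (Suc r) (Y (Suc r)) - H (y (Suc r), y r) + m r - m (Suc r))"
proof -
  have n: "n r = m r - zero_diff T r (Y r)" for r
    using degree_eq[OF spec[OF assms(3)] assms(4), of r] assms(5) by simp
  have "H_aff H (F (Suc r) (Y (Suc r))) (F r (Y r)) > 0 \<longleftrightarrow>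
      zero_diff T r (Y r) > zero_diff T (Suc r) (Y (Suc r)) - H (y (Suc r), y r) + m r - m (Suc r)" for r
    using assms(5) by (auto simp: n)
  then show ?thesis using assms(4) by (simp add: Z_Lambda0_def)
qed

end
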